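(* Let $b$ be a prime, $d\in\mathbb{N}$, let $\{\boldsymbol z_i\}_{i=0}^\infty\subset[0,1)^d$ be a digital sequence in base $b$, let $\boldsymbol\Delta\in[0,1)^d$ be a digital shift with $\mathrm{ok}(\boldsymbol z_i,\boldsymbol\Delta)=$ true for all $i\in\mathbb{N}_0$, and let $\tilde{\boldsymbol k}:\mathbb{N}_0\to\mathbb{N}_0^d$ be the wavenumber map for this digital sequence (in the algorithm below it is constructed implicitly by the Pointer Algorithm defined in the context). Let $\ell_*\in\mathbb{N}$ and let $\hat\omega,\mathring\omega$ be non-negative valued functions on $\mathbb{N}_0$ with $\lim_{m\to\infty}\mathring\omega(m)=0$. Let $r\in\mathbb{N}$ be such that $\hat\omega(r)\mathring\omega(r)<1$, and let $\mathfrak{C}(m)=\hat\omega(m)\mathring\omega(r)/[1-\hat\omega(r)\mathring\omega(r)]$. Let $\varepsilon>0$ be the error tolerance, and let $\mathcal{C}$ be the cone of integrands determined by $\ell_*,\hat\omega,\mathring\omega$ (defined in the context). If the integrand $f$ lies in $\mathcal{C}$, then the Adaptive Digital Sequence Cubature Algorithm (defined in the context) is successful: $$\Bigl|\int_{[0,1)^d} f(\boldsymbol x)\,d\boldsymbol x-\hat I_m(f)\Bigr|\le\varepsilon .$$ The number of integrand values required to obtain this answer is $b^m$, where the following upper bound on $m$ depends on the tolerance and the unknown decay rate of the Walsh coefficients: $$m\le\min\bigl\{m'\ge \ell_*+r:\ \mathfrak{C}(m')\,[1+\hat\omega(r)\mathring\omega(r)]\,S_{m'-r}(f)\le\varepsilon\bigr\}.$$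 The computational cost of this algorithm beyond that of obtaining the integrand values is $\mathcal{O}(m b^m)$ to compute the discrete Walsh transform.
   Context: **Digitwise arithmetic.** Let $b$ be prime, $\mathbb{F}_b=\{0,\dots,b-1\}$ (the field of integers mod $b$). For $\boldsymbol x,\boldsymbol t\in[0,1)^d$ write the proper $b$-ary expansions (not ending in an infinite trail of digits $b-1$) $\boldsymbol x=(\sum_{\ell\ge1}x_{j\ell}b^{-\ell})_{j=1}^d$, $\boldsymbol t=(\sum_{\ell\ge1}t_{j\ell}b^{-\ell})_{j=1}^d$. Define $\boldsymbol x\oplus\boldsymbol t=(\sum_{\ell\ge1}[(x_{j\ell}+t_{j\ell})\bmod b]b^{-\ell}\pmod 1)_{j=1}^d$, and for $a\in\mathbb{F}_b$, $a\boldsymbol x=\boldsymbol x\oplus\cdots\oplus\boldsymbol x$ ($a$ times; $\boldsymbol 0$ if $a=0$). Define $\mathrm{ok}(\boldsymbol x,\boldsymbol t)=$ true iff for every $j=1,\dots,d$ there are infinitely many $\ell$ with $(x_{j\ell}+t_{j\ell})\bmod b\ne b-1$. For $\boldsymbol k=(\sum_{\ell\ge0}k_{j\ell}b^\ell)_{j}$, $\boldsymbol l=(\sum_{\ell\ge0}l_{j\ell}b^\ell)_{j}$ in $\mathbb{N}_0^d$ (digits in $\mathbb{F}_b$), $\boldsymbol k\oplus\boldsymbol l=(\sum_\ell[(k_{j\ell}+l_{j\ell})\bmod b]b^\ell)_j$, $\ominus\boldsymbol k=(\sum_\ell[-k_{j\ell}\bmod b]b^\ell)_j$, $\boldsymbol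 k\ominus\boldsymbol l=\boldsymbol k\oplus(\ominus\boldsymbol l)$. **Pairing.** $\langle\boldsymbol k,\boldsymbol x\rangle=\sum_{j=1}^d\sum_{\ell\ge0}k_{j\ell}x_{j,\ell+1}\pmod b\in\mathbb{F}_b$ for $\boldsymbol k\in\mathbb{N}_0^d$, $\boldsymbol x\in[0,1)^d$. **Digital sequence.** A sequence $\{\boldsymbol z_i\}_{i=0}^\infty\subset[0,1)^d$ whose set of points $\mathcal{P}_\infty$ is closed under $\oplus$ with $\mathrm{ok}(\boldsymbol x,\boldsymbol t)$ true for all $\boldsymbol x,\boldsymbol t\in\mathcal{P}_\infty$ (hence $\mathcal{P}_\infty$ is an $\mathbb{F}_b$-vector space), such that $\boldsymbol z_1,\boldsymbol z_b,\boldsymbol z_{b^2},\dots$ are linearly independent over $\mathbb{F}_b$ and $\boldsymbol z_i=\bigoplus_{\ell\ge0} i_\ell\boldsymbol z_{b^\ell}$ whenever $i=\sum_{\ell\ge0} i_\ell b^\ell$ with $i_\ell\in\mathbb{F}_b$. It is also assumed that $\langle\boldsymbol k,\boldsymbol z_i\rangle=0$ for all $i\in\mathbb{N}_0$ implies $\boldsymbol k=\boldsymbol 0$. For $m\in\mathbb{N}_0$ the dual net is $\mathcal{P}_m^\perp=\{\boldsymbol k\in\mathbb{N}_0^d:\langle\boldsymbol k,\boldsymbol z_i\rangle=0,\ i=0,\dots,b^m-1\}$. **Wavenumber map.** A map $\tilde{\boldsymbol k}$ from $\mathbb{N}_0$ onto $\mathbb{N}_0^d$ such that $\tilde{\boldsymbol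 k}(0)=\boldsymbol 0$ and, for every $m\in\mathbb{N}_0$ and $\kappa\in\{0,\dots,b^m-1\}$, the values $\tilde{\boldsymbol k}(\kappa+b^m),\dots,\tilde{\boldsymbol k}(\kappa+(b-1)b^m)$ are chosen, one from each and not necessarily in that order, from the sets $\{\boldsymbol k\in\mathbb{N}_0^d:\boldsymbol k\ominus\tilde{\boldsymbol k}(\kappa)\in\mathcal{P}_m^\perp,\ \langle\boldsymbol k\ominus\tilde{\boldsymbol k}(\kappa),\boldsymbol z_{b^m}\rangle=a\}$, $a=1,\dots,b-1$. **Walsh coefficients.** For $f\in L^2([0,1)^d)$, $\hat f(\boldsymbol k)=\int_{[0,1)^d}f(\boldsymbol x)e^{-2\pi\sqrt{-1}\langle\boldsymbol k,\boldsymbol x\rangle/b}\,d\boldsymbol x$. Integrands are identified with their Walsh series: $f(\boldsymbol x)=\sum_{\boldsymbol k\in\mathbb{N}_0^d}\hat f(\boldsymbol k)e^{2\pi\sqrt{-1}\langle\boldsymbol k,\boldsymbol x\rangle/b}$, this equality being assumed to hold at the sampled points. Put $\hat I_m(f)=b^{-m}\sum_{i=0}^{b^m-1}f(\boldsymbol z_i\oplus\boldsymbol\Delta)$ and let the discrete Walsh transform be $\tilde f_m(\boldsymbol k)=b^{-m}\sum_{i=0}^{b^m-1}e^{-2\pi\sqrt{-1}\langle\boldsymbol k,\boldsymbol z_i\oplus\boldsymbol\Delta\rangle/b}f(\boldsymbol z_i\oplus\boldsymbol\Delta)$. Write $\hat f_\kappa=\hat f(\tilde{\boldsymbol k}(\kappa))$,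 $\tilde f_{m,\kappa}=\tilde f_m(\tilde{\boldsymbol k}(\kappa))$. **Sums.** For $\ell,m\in\mathbb{N}_0$, $\ell\le m$: $S_m(f)=\sum_{\kappa=\lfloor b^{m-1}\rfloor}^{b^m-1}|\hat f_\kappa|$, $\ \widehat S_{\ell,m}(f)=\sum_{\kappa=\lfloor b^{\ell-1}\rfloor}^{b^\ell-1}\sum_{\lambda=1}^\infty|\hat f_{\kappa+\lambda b^m}|$, $\ \check S_m(f)=\sum_{\kappa=b^m}^\infty|\hat f_\kappa|$, $\ \widetilde S_{\ell,m}(f)=\sum_{\kappa=\lfloor b^{\ell-1}\rfloor}^{b^\ell-1}|\tilde f_{m,\kappa}|$. **Cone.** $\mathcal{C}$ is the set of $f\in L^2([0,1)^d)$ such that $\widehat S_{\ell,m}(f)\le\hat\omega(m-\ell)\check S_m(f)$ for all $\ell\le m$, and $\check S_m(f)\le\mathring\omega(m-\ell)S_\ell(f)$ for all $\ell_*\le\ell\le m$. **Fast transform.** Put $y_i=f(\boldsymbol z_i\oplus\boldsymbol\Delta)$. For $\nu=\sum_{\ell=0}^{m-1}\nu_\ell b^\ell\in\{0,\dots,b^m-1\}$ let $Y^{(m)}_\nu=b^{-m}\sum_{i=0}^{b^m-1}e^{-2\pi\sqrt{-1}\sum_{\ell=0}^{m-1}\nu_\ell i_\ell/b}\,y_i$, where $i=\sum_{\ell=0}^{m-1}i_\ell b^\ell$. These are computed recursively by $Y_{m,0}(i_0,\dots,i_{m-1})=y_i$, $Y_{m,\ell+1}(\nu_0,\dots,\nu_\ell,i_{\ell+1},\dots,i_{m-1})=b^{-1}\sum_{i_\ell=0}^{b-1}e^{-2\pi\sqrt{-1}\nu_\ell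 i_\ell/b}\,Y_{m,\ell}(\nu_0,\dots,\nu_{\ell-1},i_\ell,\dots,i_{m-1})$, and $Y^{(m)}_\nu=Y_{m,m}(\nu_0,\dots,\nu_{m-1})$. Let $\tilde\nu_0(\boldsymbol k)=0$, $\tilde\nu_m(\boldsymbol k)=\sum_{\ell=0}^{m-1}\langle\boldsymbol k,\boldsymbol z_{b^\ell}\rangle b^\ell$ for $m\ge1$; the pointer is $\mathring\nu_m(\kappa)=\tilde\nu_m(\tilde{\boldsymbol k}(\kappa))$, $0\le\kappa<b^m$, so that $|\tilde f_{m,\kappa}|=|Y^{(m)}_{\mathring\nu_m(\kappa)}|$ and $\widetilde S_{\ell,m}(f)=\sum_{\kappa=b^{\ell-1}}^{b^\ell-1}|Y^{(m)}_{\mathring\nu_m(\kappa)}|$ for $\ell\ge1$. **Pointer Algorithm.** Instead of constructing $\tilde{\boldsymbol k}$ explicitly, the pointers $\mathring\nu_m$ are constructed directly from the data, which defines $\tilde{\boldsymbol k}$ implicitly. Input: $m\in\mathbb{N}_0$, the values $Y^{(m)}_\nu$, $0\le\nu<b^m$, and, if $m>0$, the pointer $\mathring\nu_{m-1}(\kappa)$, $0\le\kappa<b^{m-1}$. (i) If $m=0$, set $\mathring\nu_0(0)=0$ and go to (iv). (ii) If $m\ge1$, initialize $\mathring\nu_m(\kappa)=\mathring\nu_{m-1}(\kappa)$ for $0\le\kappa<b^{m-1}$ and $\mathring\nu_m(\kappa)=\kappa$ for $b^{m-1}\le\kappa\le b^m-1$. (iii) For $\ell=m-1,m-2,\dots,\max(1,m-r)$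 and, for each such $\ell$, for $\kappa=1,\dots,b^\ell-1$: find $a^*\in\mathbb{F}_b$ such that $|Y^{(m)}_{\mathring\nu_m(\kappa+a^*b^\ell)}|\ge|Y^{(m)}_{\mathring\nu_m(\kappa+ab^\ell)}|$ for all $a\in\mathbb{F}_b$, and swap the values of $\mathring\nu_m(\kappa)$ and $\mathring\nu_m(\kappa+a^*b^\ell)$. (iv) Return $\mathring\nu_m(\kappa)$, $0\le\kappa<b^m$; if $m\ge r$, also compute $\widetilde S_{m-r,m}(f)$ by the formula above in terms of $Y^{(m)}$ and $\mathring\nu_m$, and return it. **Adaptive Digital Sequence Cubature Algorithm.** Given $\ell_*,\hat\omega,\mathring\omega,r,\mathfrak{C}$ as in the claim, a tolerance $\varepsilon$, and a routine producing values of $f$, start with $m=\ell_*+r$. Step 1: compute the sum of the discrete Walsh coefficients $\widetilde S_{m-r,m}(f)$ according to the Pointer Algorithm. Step 2: if $\mathfrak{C}(m)\widetilde S_{m-r,m}(f)\le\varepsilon$, return $\hat I_m(f)$ as the answer. Step 3: otherwise increase $m$ by one and go to Step 1. In the claim, $m$ is the final value.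
   Formalization: Termination and the bound on m are claimed when the set under the minimum is nonempty (proved for bounded ω̂; it can be empty, and the algorithm run forever, if ω̂ grows); the wavenumber map is assumed to match the pointers entering the computed sums. *)

theory Defs
  imports "HOL-Analysis.Analysis"
begin

section \<open>Digitwise arithmetic\<close>

definition unit_cube :: "(real ^ 'd) set" where
  "unit_cube = {x. \<forall>j. 0 \<le> x $ j \<and> x $ j < 1}"

text \<open>For \<open>x \<in> [0,1)\<close> and \<open>l \<ge> 1\<close> this is the \<open>l\<close>-th digit of the proper expansion of \<open>x\<close>
  (the one without an infinite trail of digits \<open>b - 1\<close>), since the floor picks exactly that one.\<close>

definition rdigit :: "nat \<Rightarrow> real \<Rightarrow> nat \<Rightarrow> nat" where
  "rdigit b x l = nat (\<lfloor>x * real b ^ l\<rfloor> mod int b)"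

definition ndigit :: "nat \<Rightarrow> nat \<Rightarrow> nat \<Rightarrow> nat" where
  "ndigit b k l = (k div b ^ l) mod b"

definition dplus :: "nat \<Rightarrow> real ^ 'd \<Rightarrow> real ^ 'd \<Rightarrow> real ^ 'd" where
  "dplus b x t = (\<chi> j. frac (\<Sum>l.
     real ((rdigit b (x $ j) (Suc l) + rdigit b (t $ j) (Suc l)) mod b) / real b ^ Suc l))"

definition dscale :: "nat \<Rightarrow> nat \<Rightarrow> real ^ 'd \<Rightarrow> real ^ 'd" where
  "dscale b a x = (dplus b x ^^ a) 0"

primrec dsum :: "nat \<Rightarrow> (nat \<Rightarrow> real ^ 'd) \<Rightarrow> nat \<Rightarrow> real ^ 'd" where
  "dsum b g 0 = 0"
| "dsum b g (Suc n) = dplus b (dsum b g n) (g n)"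

definition ok :: "nat \<Rightarrow> real ^ 'd \<Rightarrow> real ^ 'd \<Rightarrow> bool" where
  "ok b x t \<longleftrightarrow> (\<forall>j. infinite
     {l. 1 \<le> l \<and> (rdigit b (x $ j) l + rdigit b (t $ j) l) mod b \<noteq> b - 1})"

text \<open>The digit sums over all \<open>l \<ge> 0\<close> are cut off where all digits vanish:
  for \<open>b \<ge> 2\<close> and \<open>l \<ge> n\<close> the \<open>l\<close>-th digit of \<open>n\<close> is \<open>0\<close>, because \<open>n < b ^ n\<close>.\<close>

definition kplus :: "nat \<Rightarrow> nat ^ 'd \<Rightarrow> nat ^ 'd \<Rightarrow> nat ^ 'd" where
  "kplus b k l = (\<chi> j. \<Sum>i<k $ j + l $ j. ((ndigit b (k $ j) i + ndigit b (l $ j) i) mod b) * b ^ i)"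

definition kneg :: "nat \<Rightarrow> nat ^ 'd \<Rightarrow> nat ^ 'd" where
  "kneg b k = (\<chi> j. \<Sum>i<k $ j. ((b - ndigit b (k $ j) i) mod b) * b ^ i)"

definition kminus :: "nat \<Rightarrow> nat ^ 'd \<Rightarrow> nat ^ 'd \<Rightarrow> nat ^ 'd" where
  "kminus b k l = kplus b k (kneg b l)"

definition pairing :: "nat \<Rightarrow> nat ^ 'd \<Rightarrow> real ^ 'd \<Rightarrow> nat" where
  "pairing b k x =
     (\<Sum>j\<in>UNIV. \<Sum>l<k $ j. ndigit b (k $ j) l * rdigit b (x $ j) (Suc l)) mod b"


section \<open>Digital sequences and wavenumber maps\<close>

definition digital_sequence :: "nat \<Rightarrow> (nat \<Rightarrow> real ^ 'd) \<Rightarrow> bool" where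
  "digital_sequence b z \<longleftrightarrow>
     range z \<subseteq> unit_cube \<and>
     (\<forall>x\<in>range z. \<forall>t\<in>range z. dplus b x t \<in> range z \<and> ok b x t) \<and>
     (\<forall>n a. (\<forall>l<n. a l < b) \<and> dsum b (\<lambda>l. dscale b (a l) (z (b ^ l))) n = 0
        \<longrightarrow> (\<forall>l<n. a l = 0)) \<and>
     (\<forall>n i. i < b ^ n \<longrightarrow> z i = dsum b (\<lambda>l. dscale b (ndigit b i l) (z (b ^ l))) n) \<and>
     (\<forall>k. (\<forall>i. pairing b k (z i) = 0) \<longrightarrow> k = 0)"

definition dual_net :: "nat \<Rightarrow> (nat \<Rightarrow> real ^ 'd) \<Rightarrow> nat \<Rightarrow> (nat ^ 'd) set" where
  "dual_net b z m = {k. \<forall>i<b ^ m. pairing b k (z i) = 0}"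

text \<open>The bijection \<open>\<pi>\<close> says which of the sets, \<open>a = 1, ..., b - 1\<close>, each value is taken from.\<close>

definition wavenumber_map :: "nat \<Rightarrow> (nat \<Rightarrow> real ^ 'd) \<Rightarrow> (nat \<Rightarrow> nat ^ 'd) \<Rightarrow> bool" where
  "wavenumber_map b z kt \<longleftrightarrow>
     surj kt \<and> kt 0 = 0 \<and>
     (\<forall>m. \<forall>\<kappa><b ^ m. \<exists>\<pi>. bij_betw \<pi> {1..<b} {1..<b} \<and>
        (\<forall>a\<in>{1..<b}. kt (\<kappa> + a * b ^ m) \<in>
           {k. kminus b k (kt \<kappa>) \<in> dual_net b z m \<and>
               pairing b (kminus b k (kt \<kappa>)) (z (b ^ m)) = \<pi> a}))"


section \<open>Walsh series and the cone of integrands\<close>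

definition walsh :: "nat \<Rightarrow> nat ^ 'd \<Rightarrow> real ^ 'd \<Rightarrow> complex" where
  "walsh b k x = exp (2 * of_real pi * \<i> * of_nat (pairing b k x) / of_nat b)"

definition square_integrable :: "(real ^ 'd \<Rightarrow> complex) \<Rightarrow> bool" where
  "square_integrable f \<longleftrightarrow>
     f \<in> borel_measurable (lebesgue_on unit_cube) \<and>
     integrable (lebesgue_on unit_cube) (\<lambda>x. (cmod (f x))\<^sup>2)"

definition cube_integral :: "(real ^ 'd \<Rightarrow> complex) \<Rightarrow> complex" where
  "cube_integral f = integral\<^sup>L (lebesgue_on unit_cube) f"

definition walsh_coeff :: "nat \<Rightarrow> (real ^ 'd \<Rightarrow> complex) \<Rightarrow> nat ^ 'd \<Rightarrow> complex" where
  "walsh_coeff b f k = cube_integral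
     (\<lambda>x. f x * exp (- (2 * of_real pi * \<i> * of_nat (pairing b k x) / of_nat b)))"

definition equals_walsh_series_at :: "nat \<Rightarrow> (real ^ 'd \<Rightarrow> complex) \<Rightarrow> real ^ 'd \<Rightarrow> bool" where
  "equals_walsh_series_at b f x \<longleftrightarrow>
     ((\<lambda>k. walsh_coeff b f k * walsh b k x) has_sum f x) UNIV"

definition sample_mean :: "nat \<Rightarrow> (nat \<Rightarrow> complex) \<Rightarrow> nat \<Rightarrow> complex" where
  "sample_mean b y m = (\<Sum>i<b ^ m. y i) / of_nat (b ^ m)"

text \<open>\<open>\<lfloor>b\<^sup>m\<^sup>-\<^sup>1\<rfloor>\<close> is \<open>b ^ m div b\<close>; in particular it is \<open>0\<close> for \<open>m = 0\<close>.\<close>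

definition block :: "nat \<Rightarrow> nat \<Rightarrow> nat set" where
  "block b m = {b ^ m div b..<b ^ m}"

text \<open>\<open>S_hat\<close> and \<open>S_check\<close> are infinite sums of non-negative terms; they take the value \<open>\<infinity>\<close>
  when they diverge.\<close>

definition S_fin :: "nat \<Rightarrow> (nat \<Rightarrow> nat ^ 'd) \<Rightarrow> (real ^ 'd \<Rightarrow> complex) \<Rightarrow> nat \<Rightarrow> real" where
  "S_fin b kt f m = (\<Sum>\<kappa>\<in>block b m. cmod (walsh_coeff b f (kt \<kappa>)))"

definition S_hat :: "nat \<Rightarrow> (nat \<Rightarrow> nat ^ 'd) \<Rightarrow> (real ^ 'd \<Rightarrow> complex) \<Rightarrow> nat \<Rightarrow> nat \<Rightarrow> ennreal" where
  "S_hat b kt f l m = (\<Sum>\<kappa>\<in>block b l. \<Sum>j.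
     ennreal (cmod (walsh_coeff b f (kt (\<kappa> + Suc j * b ^ m)))))"

definition S_check :: "nat \<Rightarrow> (nat \<Rightarrow> nat ^ 'd) \<Rightarrow> (real ^ 'd \<Rightarrow> complex) \<Rightarrow> nat \<Rightarrow> ennreal" where
  "S_check b kt f m = (\<Sum>\<kappa>. ennreal (cmod (walsh_coeff b f (kt (b ^ m + \<kappa>)))))"

definition integrand_cone ::
  "nat \<Rightarrow> (nat \<Rightarrow> nat ^ 'd) \<Rightarrow> nat \<Rightarrow> (nat \<Rightarrow> real) \<Rightarrow> (nat \<Rightarrow> real) \<Rightarrow> (real ^ 'd \<Rightarrow> complex) set" where
  "integrand_cone b kt lstar \<omega>hat \<omega>ring = {f. square_integrable f \<and>
     (\<forall>l m. l \<le> m \<longrightarrow> S_hat b kt f l m \<le> ennreal (\<omega>hat (m - l)) * S_check b kt f m) \<and>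
     (\<forall>l m. lstar \<le> l \<and> l \<le> m \<longrightarrow>
        S_check b kt f m \<le> ennreal (\<omega>ring (m - l)) * ennreal (S_fin b kt f l))}"

definition err_factor :: "(nat \<Rightarrow> real) \<Rightarrow> (nat \<Rightarrow> real) \<Rightarrow> nat \<Rightarrow> nat \<Rightarrow> real" where
  "err_factor \<omega>hat \<omega>ring r m = \<omega>hat m * \<omega>ring r / (1 - \<omega>hat r * \<omega>ring r)"


section \<open>Programs with cost\<close>

text \<open>A program returns its result together with the number of elementary operations used. One unit
  is charged for an addition or multiplication of numbers, a modulus, a comparison, a swap, or the
  writing of an array cell; lists play the role of arrays.\<close>

type_synonym 'a costed = "'a \<times> nat"

definition and_then :: "'a costed \<Rightarrow> ('a \<Rightarrow> 'b costed) \<Rightarrow> 'b costed" (infixl "\<triangleright>" 54) where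
  "p \<triangleright> g = (fst (g (fst p)), snd p + snd (g (fst p)))"

primrec for_each :: "'a list \<Rightarrow> ('a \<Rightarrow> 's \<Rightarrow> 's costed) \<Rightarrow> 's \<Rightarrow> 's costed" where
  "for_each [] body s = (s, 0)"
| "for_each (x # xs) body s = body x s \<triangleright> for_each xs body"

definition map_costed :: "('a \<Rightarrow> 'b costed) \<Rightarrow> 'a list \<Rightarrow> 'b list costed" where
  "map_costed g xs = (map (\<lambda>x. fst (g x)) xs, \<Sum>x\<leftarrow>xs. snd (g x))"


section \<open>Fast transform\<close>

text \<open>The array for \<open>Y\<^sub>m\<^sub>,\<^sub>l\<close> holds its value at the digit vector \<open>(c\<^sub>0, ..., c\<^sub>m\<^sub>-\<^sub>1)\<close> in the cell with
  index \<open>\<Sum>\<^sub>i c\<^sub>i b\<^sup>i\<close>.\<close>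

definition butterfly :: "nat \<Rightarrow> nat \<Rightarrow> complex list \<Rightarrow> nat \<Rightarrow> complex costed" where
  "butterfly b l A n =
     (let \<nu> = ndigit b n l; base = n - \<nu> * b ^ l in
      for_each [0..<b] (\<lambda>i s.
          (s + exp (- (2 * of_real pi * \<i> * of_nat (\<nu> * i) / of_nat b)) * A ! (base + i * b ^ l), 2)) 0
      \<triangleright> (\<lambda>s. (s / of_nat b, 1)))"

definition transform_stage :: "nat \<Rightarrow> nat \<Rightarrow> nat \<Rightarrow> complex list \<Rightarrow> complex list costed" where
  "transform_stage b m l A =
     map_costed (butterfly b l A) [0..<b ^ m] \<triangleright> (\<lambda>A'. (A', length A'))"

definition fast_transform :: "nat \<Rightarrow> nat \<Rightarrow> complex list \<Rightarrow> complex list costed" where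
  "fast_transform b m ys = for_each [0..<m] (transform_stage b m) ys"


section \<open>Pointer algorithm\<close>

text \<open>The algorithm only asks for some \<open>a\<^sup>*\<close> with the largest modulus. A selection rule fixes how ties
  are broken, possibly in a different way at each place \<open>(m, l, \<kappa>)\<close>; quantifying over all rules
  covers all possible executions.\<close>

type_synonym selection_rule = "nat \<Rightarrow> nat \<Rightarrow> nat \<Rightarrow> (nat \<Rightarrow> real) \<Rightarrow> nat"

definition selects_max :: "nat \<Rightarrow> selection_rule \<Rightarrow> bool" where
  "selects_max b sel \<longleftrightarrow>
     (\<forall>m l \<kappa> w. sel m l \<kappa> w < b \<and> (\<forall>a<b. w a \<le> w (sel m l \<kappa> w)))"

text \<open>Finding \<open>a\<^sup>*\<close> takes \<open>b\<close> moduli and \<open>b\<close> comparisons, followed by one swap.\<close>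

definition swap_step ::
  "nat \<Rightarrow> selection_rule \<Rightarrow> nat \<Rightarrow> complex list \<Rightarrow> nat \<Rightarrow> nat \<Rightarrow> nat list \<Rightarrow> nat list costed" where
  "swap_step b sel m Y l \<kappa> \<nu> =
     (let a = sel m l \<kappa> (\<lambda>a. cmod (Y ! (\<nu> ! (\<kappa> + a * b ^ l)))); \<kappa>' = \<kappa> + a * b ^ l in
      (\<nu>[\<kappa> := \<nu> ! \<kappa>', \<kappa>' := \<nu> ! \<kappa>], 2 * b + 1))"

definition pointer_algorithm ::
  "nat \<Rightarrow> nat \<Rightarrow> selection_rule \<Rightarrow> nat \<Rightarrow> complex list \<Rightarrow> nat list \<Rightarrow> (nat list \<times> real option) costed" where
  "pointer_algorithm b r sel m Y \<nu>\<^sub>p\<^sub>r\<^sub>e\<^sub>v =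
     (if m = 0 then ([0], 1)
      else (\<nu>\<^sub>p\<^sub>r\<^sub>e\<^sub>v @ [b ^ (m - 1)..<b ^ m], b ^ m)
        \<triangleright> for_each (rev [max 1 (m - r)..<m]) (\<lambda>l.
             for_each [1..<b ^ l] (\<lambda>\<kappa>. swap_step b sel m Y l \<kappa>)))
     \<triangleright> (\<lambda>\<nu>.
       if m < r then ((\<nu>, None), 0)
       else for_each [b ^ (m - r) div b..<b ^ (m - r)]
              (\<lambda>\<kappa> s. (s + cmod (Y ! (\<nu> ! \<kappa>)), 2)) 0
            \<triangleright> (\<lambda>s. ((\<nu>, Some s), 0)))"

definition level_step ::
  "nat \<Rightarrow> nat \<Rightarrow> selection_rule \<Rightarrow> complex list \<Rightarrow> nat \<Rightarrow> nat list \<Rightarrow> (nat list \<times> real option) costed" where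
  "level_step b r sel ys m \<nu> =
     fast_transform b m (take (b ^ m) ys) \<triangleright> (\<lambda>Y. pointer_algorithm b r sel m Y \<nu>)"

text \<open>The levels \<open>0, ..., M - 1\<close>, leading to the pointer of level \<open>M - 1\<close>. The initial \<open>[]\<close> is
  ignored by level \<open>0\<close>.\<close>

definition levels_below ::
  "nat \<Rightarrow> nat \<Rightarrow> selection_rule \<Rightarrow> complex list \<Rightarrow> nat \<Rightarrow> nat list costed" where
  "levels_below b r sel ys M =
     for_each [0..<M] (\<lambda>m \<nu>. level_step b r sel ys m \<nu> \<triangleright> (\<lambda>(\<nu>', S). (\<nu>', 0))) []"

definition pointer :: "nat \<Rightarrow> nat \<Rightarrow> selection_rule \<Rightarrow> (nat \<Rightarrow> complex) \<Rightarrow> nat \<Rightarrow> nat \<Rightarrow> nat" where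
  "pointer b r sel y m \<kappa> = fst (levels_below b r sel (map y [0..<b ^ m]) (Suc m)) ! \<kappa>"

definition nu_tilde :: "nat \<Rightarrow> (nat \<Rightarrow> real ^ 'd) \<Rightarrow> nat \<Rightarrow> nat ^ 'd \<Rightarrow> nat" where
  "nu_tilde b z m k = (\<Sum>l<m. pairing b k (z (b ^ l)) * b ^ l)"


section \<open>Adaptive cubature\<close>

definition mean_costed :: "complex list \<Rightarrow> complex costed" where
  "mean_costed ys = for_each ys (\<lambda>v s. (s + v, 1)) 0 \<triangleright> (\<lambda>s. (s / of_nat (length ys), 1))"

text \<open>The function \<open>y\<close> is the routine producing the integrand values. Each entry of the list \<open>ys\<close> of
  stored values comes from one call of \<open>y\<close>, so the length of the final list is the number of calls.
  The result consists of the answer, the final level, the number of integrand values used, and the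
  cost of everything else; it is \<open>None\<close> if the loop runs forever. One multiplication and one
  comparison are charged for the stopping test.\<close>

partial_function (option) adaptive_loop ::
  "nat \<Rightarrow> nat \<Rightarrow> selection_rule \<Rightarrow> (nat \<Rightarrow> complex) \<Rightarrow> (nat \<Rightarrow> real) \<Rightarrow> real \<Rightarrow>
   nat \<Rightarrow> nat list \<Rightarrow> complex list \<Rightarrow> nat \<Rightarrow> (complex \<times> nat \<times> nat \<times> nat) option" where
  "adaptive_loop b r sel y C \<epsilon> m \<nu> ys c =
     (let ys' = ys @ map y [length ys..<b ^ m];
          step = level_step b r sel ys' m \<nu>;
          \<nu>' = fst (fst step);
          S = the (snd (fst step));
          c' = c + snd step + 2
      in if C m * S \<le> \<epsilon>
         then Some (fst (mean_costed ys'), m, length ys', c' + snd (mean_costed ys'))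
         else adaptive_loop b r sel y C \<epsilon> (Suc m) \<nu>' ys' c')"

definition adaptive_cubature ::
  "nat \<Rightarrow> nat \<Rightarrow> (nat \<Rightarrow> real) \<Rightarrow> (nat \<Rightarrow> real) \<Rightarrow> nat \<Rightarrow> selection_rule \<Rightarrow> real \<Rightarrow> (nat \<Rightarrow> complex) \<Rightarrow>
   (complex \<times> nat \<times> nat \<times> nat) option" where
  "adaptive_cubature b lstar \<omega>hat \<omega>ring r sel \<epsilon> y =
     (let m\<^sub>0 = lstar + r;
          ys = map y [0..<b ^ m\<^sub>0];
          start = levels_below b r sel ys m\<^sub>0
      in adaptive_loop b r sel y (err_factor \<omega>hat \<omega>ring r) \<epsilon> m\<^sub>0 (fst start) ys (snd start))"

text \<open>The pointers determine the wavenumber map only implicitly, as a map \<open>kt\<close> such that the pointer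
  at \<open>\<kappa>\<close> is \<open>nu_tilde\<close> of \<open>kt \<kappa>\<close>. This is demanded for the pointer values which enter the sum returned
  at each level \<open>m\<close> that the run with result \<open>out\<close> goes through, and not for the other ones: a
  pointer may be swapped again at a later level, where different \<open>\<kappa>\<close> enter the sum.\<close>

definition constructed_by_pointers ::
  "nat \<Rightarrow> (nat \<Rightarrow> real ^ 'd) \<Rightarrow> nat \<Rightarrow> nat \<Rightarrow> selection_rule \<Rightarrow> (nat \<Rightarrow> complex) \<Rightarrow>
   (complex \<times> nat \<times> nat \<times> nat) option \<Rightarrow> (nat \<Rightarrow> nat ^ 'd) \<Rightarrow> bool" where
  "constructed_by_pointers b z lstar r sel y out kt \<longleftrightarrow>
     (\<forall>m \<ge> lstar + r. (\<forall>Q m' n c. out = Some (Q, m', n, c) \<longrightarrow> m \<le> m') \<longrightarrow>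
        (\<forall>\<kappa>\<in>block b (m - r). pointer b r sel y m \<kappa> = nu_tilde b z m (kt \<kappa>)))"

definition sufficient_levels ::
  "nat \<Rightarrow> (nat \<Rightarrow> nat ^ 'd) \<Rightarrow> nat \<Rightarrow> (nat \<Rightarrow> real) \<Rightarrow> (nat \<Rightarrow> real) \<Rightarrow> nat \<Rightarrow> real \<Rightarrow>
   (real ^ 'd \<Rightarrow> complex) \<Rightarrow> nat set" where
  "sufficient_levels b kt lstar \<omega>hat \<omega>ring r \<epsilon> f =
     {m'. lstar + r \<le> m' \<and>
          err_factor \<omega>hat \<omega>ring r m' * (1 + \<omega>hat r * \<omega>ring r) * S_fin b kt f (m' - r) \<le> \<epsilon>}"

end

theory Submission
  imports Defs "HOL-Number_Theory.Cong"
begin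

text \<open>Two wavenumbers are aliased by the first \<open>b ^ m\<close> points exactly if they pair equally with
  \<open>z (b ^ l)\<close> for all \<open>l < m\<close>, and \<open>kt\<close> is a bijection which turns this relation into congruence
  modulo \<open>b ^ m\<close>. Hence the discrete Walsh coefficient at \<open>kt \<kappa>\<close>, \<open>\<kappa> < b ^ m\<close>, is the sum of the
  Walsh coefficients at \<open>kt (\<kappa> + j * b ^ m)\<close>, \<open>j \<ge> 0\<close>, up to phases; for \<open>\<kappa> = 0\<close> it is the sample
  mean. So the error is at most \<open>S_hat 0 m\<close>, and the computed sum differs from \<open>S_fin (m - r)\<close> by at
  most \<open>S_hat (m - r) m\<close>. The cone bounds both by multiples of \<open>S_fin (m - r)\<close>, the second one by
  \<open>\<omega>hat r * \<omega>ring r < 1\<close> times it, so that \<open>S_fin (m - r)\<close> is controlled by the computed sum and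
  vice versa. The cost of level \<open>m\<close> is \<open>O(m b\<^sup>m)\<close>, and these costs grow geometrically.\<close>

section \<open>Digits\<close>

lemma ndigit_less: "0 < b \<Longrightarrow> ndigit b n l < b"
  by (simp add: ndigit_def)

lemma ndigit_eq_0: "n < b ^ l \<Longrightarrow> ndigit b n l = 0"
  by (simp add: ndigit_def)

lemma ndigit_cutoff: "1 < b \<Longrightarrow> n \<le> l \<Longrightarrow> ndigit b n l = 0"
  using power_gt_expt[of b l] by (intro ndigit_eq_0) linarith

text \<open>A multiple of \<open>b ^ n\<close> with \<open>n > l\<close> changes the quotient by
  \<open>b ^ l\<close> only by a multiple of \<open>b\<close>.\<close>

lemma ndigit_add_low:
  assumes "0 < b" "l < n"
  shows "ndigit b (s + q * b ^ n) l = ndigit b s l"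
proof -
  obtain e where e: "n = l + Suc e" using assms(2) less_iff_Suc_add by auto
  have "s + q * b ^ n = s + (q * b ^ e * b) * b ^ l"
    by (simp add: e power_add)
  then have "(s + q * b ^ n) div b ^ l = s div b ^ l + q * b ^ e * b"
    using assms(1) by (simp only: div_mult_self1) simp
  then show ?thesis by (simp add: ndigit_def)
qed

lemma ndigit_add_top: "s < b ^ n \<Longrightarrow> q < b \<Longrightarrow> ndigit b (s + q * b ^ n) n = q"
  by (simp add: ndigit_def)

lemma add_top_digit_less:
  fixes b :: nat
  assumes "s < b ^ n" "q < b"
  shows "s + q * b ^ n < b ^ Suc n"
proof -
  have "s + q * b ^ n < Suc q * b ^ n" using assms(1) by simp
  also have "\<dots> \<le> b * b ^ n" using assms(2) by (intro mult_le_mono1) simp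
  finally show ?thesis by simp
qed

lemma digit_sum_less:
  fixes b :: nat
  shows "(\<And>i. i < n \<Longrightarrow> c i < b) \<Longrightarrow> (\<Sum>i<n. c i * b ^ i) < b ^ n"
proof (induction n)
  case (Suc n)
  then show ?case using add_top_digit_less[of "\<Sum>i<n. c i * b ^ i" b n "c n"] by simp
qed simp

text \<open>Uniqueness of the base-\<open>b\<close> expansion. \<open>kplus\<close>,
  \<open>kneg\<close> and \<open>nu_tilde\<close> are built as digit sums, and this is how their
  digits are read off.\<close>

lemma ndigit_digit_sum:
  assumes "0 < b" "\<And>i. i < n \<Longrightarrow> c i < b"
  shows "ndigit b (\<Sum>i<n. c i * b ^ i) l = (if l < n then c l else 0)"
  using assms(2)
proof (induction n)
  case 0
  show ?case by (simp add: ndigit_def)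
next
  case (Suc n)
  let ?s = "\<Sum>i<n. c i * b ^ i"
  have s: "?s < b ^ n" using Suc.prems by (intro digit_sum_less) simp
  have IH: "ndigit b ?s l = (if l < n then c l else 0)" using Suc by simp
  consider "l < n" | "l = n" | "Suc n \<le> l" by linarith
  then show ?case
  proof cases
    case 1
    then show ?thesis using IH ndigit_add_low[OF assms(1)] by simp
  next
    case 2
    then show ?thesis using ndigit_add_top[OF s] Suc.prems by simp
  next
    case 3
    have "(\<Sum>i<Suc n. c i * b ^ i) < b ^ Suc n" using Suc.prems by (intro digit_sum_less) simp
    also have "\<dots> \<le> b ^ l" using 3 assms(1) by (intro power_increasing) auto
    finally show ?thesis using 3 ndigit_eq_0 by (metis not_less_eq_eq order.strict_iff_not)
  qed
qed

text \<open>The tails \<open>T L\<close> of the expansion satisfy \<open>b * T L = c L + T (Suc L)\<close>. Hence \<open>T L \<le> 1\<close>, with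
  equality only if all digits from \<open>L\<close> on are \<open>b - 1\<close>.\<close>

lemma rdigit_digit_series:
  fixes c :: "nat \<Rightarrow> nat"
  assumes b: "1 < b" and c: "\<And>l. c l < b" and inf: "infinite {l. c l \<noteq> b - 1}"
  defines "s \<equiv> (\<Sum>l. real (c l) / real b ^ Suc l)"
  shows "0 \<le> s" "s < 1" "rdigit b s (Suc l) = c l"
proof -
  define T where "T L = (\<Sum>l. real (c (l + L)) / real b ^ Suc l)" for L
  \<comment> \<open>The series with all digits \<open>b - 1\<close>; it dominates every
    tail.\<close>
  have geo: "(\<lambda>l. (real b - 1) / real b ^ Suc l) sums 1"
  proof -
    have "(\<lambda>l. (1 / real b) ^ l) sums (1 / (1 - 1 / real b))"
      using b by (intro geometric_sums) simp
    then have "(\<lambda>l. ((real b - 1) / real b) * (1 / real b) ^ l)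
        sums (((real b - 1) / real b) * (1 / (1 - 1 / real b)))"
      by (rule sums_mult)
    moreover have "((real b - 1) / real b) * (1 / (1 - 1 / real b)) = 1"
      using b by (simp add: field_simps)
    moreover have "(\<lambda>l. ((real b - 1) / real b) * (1 / real b) ^ l)
        = (\<lambda>l. (real b - 1) / real b ^ Suc l)"
      by (simp add: power_divide mult.commute)
    ultimately show ?thesis by metis
  qed
  have le: "real (c (l + L)) / real b ^ Suc l \<le> (real b - 1) / real b ^ Suc l" for l L
    using c[of "l + L"] b by (intro divide_right_mono) auto
  have sm: "summable (\<lambda>l. real (c (l + L)) / real b ^ Suc l)" for L
    by (rule summable_comparison_test'[OF sums_summable[OF geo], of 0]) (use le in auto)
  have T0: "0 \<le> T L" for L
    unfolding T_def by (intro suminf_nonneg sm) auto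
  have T1: "T L \<le> 1" for L
    unfolding T_def using suminf_le[OF le sm sums_summable[OF geo]] geo
    by (metis sums_unique)
  have rec: "real b * T L = real (c L) + T (Suc L)" for L
  proof -
    have "T L = real (c L) / real b + (\<Sum>l. real (c (Suc l + L)) / real b ^ Suc (Suc l))"
      unfolding T_def using suminf_split_head[OF sm, of L] by simp
    also have "(\<lambda>l. real (c (Suc l + L)) / real b ^ Suc (Suc l))
        = (\<lambda>l. real (c (l + Suc L)) / real b ^ Suc l / real b)"
      by (simp add: mult.commute)
    also have "(\<Sum>l. real (c (l + Suc L)) / real b ^ Suc l / real b) = T (Suc L) / real b"
      unfolding T_def by (rule suminf_divide[OF sm])
    finally show ?thesis using b by (simp add: field_simps)
  qed
  have T_step: "T L < 1" if "c L \<noteq> b - 1 \<or> T (Suc L) < 1" for L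
  proof -
    have "real (c L) \<le> real b - 1" using c[of L] by linarith
    moreover have "real (c L) < real b - 1" if "c L \<noteq> b - 1"
      using that c[of L] by linarith
    ultimately have "real b * T L < real b * 1"
      using rec[of L] T1[of "Suc L"] that by linarith
    then show ?thesis using b by (simp add: mult_less_cancel_left)
  qed
  \<comment> \<open>Some digit at a place \<open>M \<ge> L\<close> differs from
    \<open>b - 1\<close>, which gives \<open>T M < 1\<close>; the strict bound is carried down from
    \<open>M\<close> to \<open>L\<close> by \<open>T_step\<close>.\<close>
  have T_less: "T L < 1" for L
  proof -
    obtain M where M: "L \<le> M" "c M \<noteq> b - 1"
      using inf unfolding infinite_nat_iff_unbounded_le by blast
    from M(1) show ?thesis
    proof (induction rule: inc_induct)
      case base
      show ?case using M(2) using T_step by blast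
    next
      case (step n)
      then show ?case using T_step by blast
    qed
  qed
  have sT: "s = T 0" by (simp add: s_def T_def)
  show "0 \<le> s" "s < 1" using sT T0 T_less by auto
  \<comment> \<open>Multiplication by \<open>b ^ L\<close> moves the first \<open>L\<close> digits
    into the integer part and leaves the tail \<open>T L\<close>. As
    \<open>0 \<le> T (Suc l) < 1\<close>, the floor exposes the digit \<open>c l\<close> modulo
    \<open>b\<close>.\<close>
  have "\<exists>N::int. s * real b ^ L = of_int N + T L" for L
  proof (induction L)
    case 0
    show ?case by (rule exI[of _ 0]) (simp add: sT)
  next
    case (Suc L)
    then obtain N :: int where N: "s * real b ^ L = of_int N + T L" by blast
    have "s * real b ^ Suc L = real b * (s * real b ^ L)" by simp
    also have "\<dots> = of_int (int b * N + int (c L)) + T (Suc L)"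
      using rec[of L] by (simp add: N distrib_left)
    finally show ?case by blast
  qed
  then obtain N :: int where N: "s * real b ^ l = of_int N + T l" by blast
  have "s * real b ^ Suc l = real b * (s * real b ^ l)" by simp
  also have "\<dots> = of_int (int b * N + int (c l)) + T (Suc l)"
    using rec[of l] by (simp add: N distrib_left)
  finally have "\<lfloor>s * real b ^ Suc l\<rfloor> = int b * N + int (c l)"
    using T0[of "Suc l"] T_less[of "Suc l"] by (intro floor_unique) simp_all
  then show "rdigit b s (Suc l) = c l"
    using c[of l] by (simp add: rdigit_def)
qed

text \<open>The condition \<open>ok\<close> says that the digitwise sum is a proper expansion. Its
  series is then below 1, so \<open>frac\<close> changes nothing, and its digits are the prescribed
  ones.\<close>

lemma rdigit_dplus:
  assumes b: "1 < b" and ok: "ok b x t"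
  shows "rdigit b (dplus b x t $ j) (Suc l)
    = (rdigit b (x $ j) (Suc l) + rdigit b (t $ j) (Suc l)) mod b"
proof -
  let ?c = "\<lambda>l. (rdigit b (x $ j) (Suc l) + rdigit b (t $ j) (Suc l)) mod b"
  have "infinite {l. 1 \<le> l \<and> (rdigit b (x $ j) l + rdigit b (t $ j) l) mod b \<noteq> b - 1}"
    using ok by (auto simp: ok_def)
  \<comment> \<open>Digit places are counted from 1, terms of the series from 0.\<close>
  also have "{l. 1 \<le> l \<and> (rdigit b (x $ j) l + rdigit b (t $ j) l) mod b \<noteq> b - 1}
      = Suc ` {l. ?c l \<noteq> b - 1}"
    by (auto simp: image_iff) (metis Suc_pred' less_eq_Suc_le One_nat_def)
  finally have inf: "infinite {l. ?c l \<noteq> b - 1}" using finite_imageI by blast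
  have less: "?c l < b" for l using b by simp
  show ?thesis
    using rdigit_digit_series[OF b, of ?c, OF less inf]
    by (simp add: dplus_def frac_eq del: power_Suc)
qed


section \<open>Additivity of the pairing\<close>

lemma pairing_less: "0 < b \<Longrightarrow> pairing b k x < b"
  by (simp add: pairing_def)

text \<open>A cutoff common to all coordinates, and possibly to several wavenumbers, allows pairings
  to be compared term by term.\<close>

lemma pairing_cutoff:
  assumes "1 < b" and n: "\<And>j. k $ j \<le> n"
  shows "pairing b k x = (\<Sum>j\<in>UNIV. \<Sum>l<n. ndigit b (k $ j) l * rdigit b (x $ j) (Suc l)) mod b"
proof -
  have "(\<Sum>l<k $ j. ndigit b (k $ j) l * rdigit b (x $ j) (Suc l))
      = (\<Sum>l<n. ndigit b (k $ j) l * rdigit b (x $ j) (Suc l))" for j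
    by (rule sum.mono_neutral_left) (use n[of j] ndigit_cutoff[OF assms(1)] in auto)
  then show ?thesis by (simp add: pairing_def)
qed

lemma vec_nat_bound:
  fixes k :: "nat ^ 'd"
  obtains n where "\<And>j. k $ j \<le> n"
proof
  show "k $ j \<le> (\<Sum>j\<in>UNIV. k $ j)" for j by (rule member_le_sum) auto
qed

lemma pairing_dplus:
  assumes "1 < b" "ok b x t"
  shows "[pairing b k (dplus b x t) = pairing b k x + pairing b k t] (mod b)"
proof -
  let ?p = "\<lambda>x j l. ndigit b (k $ j) l * rdigit b (x $ j) (Suc l)"
  have "[pairing b k (dplus b x t) = (\<Sum>j\<in>UNIV. \<Sum>l<k $ j. ?p (dplus b x t) j l)] (mod b)"
    by (simp add: pairing_def)
  also have "[(\<Sum>j\<in>UNIV. \<Sum>l<k $ j. ?p (dplus b x t) j l)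
      = (\<Sum>j\<in>UNIV. \<Sum>l<k $ j. ?p x j l + ?p t j l)] (mod b)"
    by (intro cong_sum) (simp add: rdigit_dplus[OF assms] cong_def mod_mult_right_eq
        flip: distrib_left)
  also have "[(\<Sum>j\<in>UNIV. \<Sum>l<k $ j. ?p x j l + ?p t j l)
      = pairing b k x + pairing b k t] (mod b)"
    by (simp add: pairing_def sum.distrib cong_def mod_add_eq)
  finally show ?thesis .
qed

lemma pairing_zero_right: "pairing b k 0 = 0"
  by (simp add: pairing_def rdigit_def)

lemma pairing_zero_left: "pairing b 0 x = 0"
  by (simp add: pairing_def)

text \<open>Truncating the defining sum at \<open>k $ j + l $ j\<close> loses nothing, because both
  digits vanish from there on.\<close>

lemma ndigit_kplus:
  assumes "1 < b"
  shows "ndigit b (kplus b k l $ j) i = (ndigit b (k $ j) i + ndigit b (l $ j) i) mod b"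
proof (cases "i < k $ j + l $ j")
  case True
  then show ?thesis using assms by (simp add: kplus_def ndigit_digit_sum)
next
  case False
  then show ?thesis using assms by (simp add: kplus_def ndigit_digit_sum ndigit_cutoff)
qed

text \<open>Beyond the cutoff the digit of \<open>k\<close> is 0, and the outer \<open>mod b\<close>
  turns \<open>b - 0\<close> into 0 as well.\<close>

lemma ndigit_kneg:
  assumes "1 < b"
  shows "ndigit b (kneg b k $ j) i = (b - ndigit b (k $ j) i) mod b"
proof (cases "i < k $ j")
  case True
  then show ?thesis using assms by (simp add: kneg_def ndigit_digit_sum)
next
  case False
  then show ?thesis using assms by (simp add: kneg_def ndigit_digit_sum ndigit_cutoff)
qed

text \<open>Stated as a sum to avoid truncated subtraction. Digit by digit,
  \<open>kminus b k l\<close> plus \<open>l\<close> is \<open>k\<close> modulo \<open>b\<close>, and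
  the pairing is linear in the digits.\<close>

lemma pairing_kminus:
  assumes b: "1 < b"
  shows "[pairing b (kminus b k l) x + pairing b l x = pairing b k x] (mod b)"
proof -
  obtain n1 where n1: "\<And>j. k $ j \<le> n1" by (rule vec_nat_bound[of k]) blast
  obtain n2 where n2: "\<And>j. l $ j \<le> n2" by (rule vec_nat_bound[of l]) blast
  obtain n3 where n3: "\<And>j. kminus b k l $ j \<le> n3" by (rule vec_nat_bound[of "kminus b k l"]) blast
  \<comment> \<open>One cutoff that serves all three wavenumbers.\<close>
  define n where "n = n1 + n2 + n3"
  have n: "k $ j \<le> n" "l $ j \<le> n" "kminus b k l $ j \<le> n" for j
    using n1[of j] n2[of j] n3[of j] by (auto simp: n_def)
  let ?p = "\<lambda>k j i. ndigit b (k $ j) i * rdigit b (x $ j) (Suc i)"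
  have dig: "[ndigit b (kminus b k l $ j) i + ndigit b (l $ j) i = ndigit b (k $ j) i] (mod b)" for j i
  proof -
    have "ndigit b (kminus b k l $ j) i
        = (ndigit b (k $ j) i + (b - ndigit b (l $ j) i)) mod b"
      using b by (simp add: kminus_def ndigit_kplus ndigit_kneg mod_add_right_eq)
    \<comment> \<open>This makes \<open>b - ndigit b (l $ j) i\<close> a genuine difference.\<close>
    moreover have "ndigit b (l $ j) i < b" using b by (simp add: ndigit_less)
    ultimately show ?thesis by (simp add: cong_def mod_add_left_eq)
  qed
  have "[pairing b (kminus b k l) x + pairing b l x
      = (\<Sum>j\<in>UNIV. \<Sum>i<n. ?p (kminus b k l) j i + ?p l j i)] (mod b)"
    by (simp add: pairing_cutoff[OF b n(2)] pairing_cutoff[OF b n(3)] cong_def sum.distrib mod_add_eq)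
  also have "[(\<Sum>j\<in>UNIV. \<Sum>i<n. ?p (kminus b k l) j i + ?p l j i)
      = (\<Sum>j\<in>UNIV. \<Sum>i<n. ?p k j i)] (mod b)"
    unfolding distrib_right[symmetric] by (intro cong_sum cong_mult dig cong_refl)
  also have "[(\<Sum>j\<in>UNIV. \<Sum>i<n. ?p k j i) = pairing b k x] (mod b)"
    by (simp add: pairing_cutoff[OF b n(1)] cong_def)
  finally show ?thesis .
qed

text \<open>Pairing with a fixed \<open>k\<close> is additive on the points of the sequence, so the
  expansion of \<open>z i\<close> in the generators \<open>z (b ^ l)\<close> reduces it to finitely
  many values.\<close>

lemma pairing_digital_sequence:
  assumes b: "1 < b" and z: "digital_sequence b z" and i: "i < b ^ m"
  shows "[pairing b k (z i) = (\<Sum>l<m. ndigit b i l * pairing b k (z (b ^ l)))] (mod b)"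
proof -
  have closed: "dplus b x t \<in> range z" "ok b x t" if "x \<in> range z" "t \<in> range z" for x t
    using z that by (auto simp: digital_sequence_def)
  have expansion: "z i = dsum b (\<lambda>l. dscale b (ndigit b i l) (z (b ^ l))) n" if "i < b ^ n" for i n
    using z that by (auto simp: digital_sequence_def)
  have "z 0 = 0" using expansion[of 0 0] by simp
  then have zero: "0 \<in> range z" by (metis rangeI)
  \<comment> \<open>Membership in \<open>range z\<close> is carried along in both inductions, since
    \<open>ok\<close>, and with it additivity, is available only for points of the sequence.\<close>
  have scale: "dscale b a x \<in> range z \<and> [pairing b k (dscale b a x) = a * pairing b k x] (mod b)"
    if x: "x \<in> range z" for a x
  proof (induction a)
    case 0
    show ?case using zero by (simp add: dscale_def pairing_zero_right)
  next
    case (Suc a)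
    have eq: "dscale b (Suc a) x = dplus b x (dscale b a x)" by (simp add: dscale_def)
    have "[pairing b k (dscale b (Suc a) x) = pairing b k x + pairing b k (dscale b a x)] (mod b)"
      unfolding eq using closed x Suc by (intro pairing_dplus[OF b]) blast
    also have "[pairing b k x + pairing b k (dscale b a x) = pairing b k x + a * pairing b k x] (mod b)"
      using Suc by (intro cong_add cong_refl) blast
    finally show ?case using closed x Suc eq by simp
  qed
  have "dsum b g n \<in> range z \<and> [pairing b k (dsum b g n) = (\<Sum>l<n. pairing b k (g l))] (mod b)"
    if g: "\<And>l. g l \<in> range z" for g n
  proof (induction n)
    case 0
    show ?case using zero by (simp add: pairing_zero_right)
  next
    case (Suc n)
    have "[pairing b k (dsum b g (Suc n)) = pairing b k (dsum b g n) + pairing b k (g n)] (mod b)"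
      using closed g Suc by (simp add: pairing_dplus[OF b])
    also have "[pairing b k (dsum b g n) + pairing b k (g n)
        = (\<Sum>l<n. pairing b k (g l)) + pairing b k (g n)] (mod b)"
      using Suc by (intro cong_add cong_refl) blast
    finally show ?case using closed g Suc by simp
  qed
  from this[of "\<lambda>l. dscale b (ndigit b i l) (z (b ^ l))" m]
  have "[pairing b k (z i) = (\<Sum>l<m. pairing b k (dscale b (ndigit b i l) (z (b ^ l))))] (mod b)"
    unfolding expansion[OF i, symmetric] using scale by blast
  also have "[(\<Sum>l<m. pairing b k (dscale b (ndigit b i l) (z (b ^ l))))
      = (\<Sum>l<m. ndigit b i l * pairing b k (z (b ^ l)))] (mod b)"
    using scale by (intro cong_sum) blast
  finally show ?thesis .
qed


section \<open>Additive characters\<close>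

text \<open>The standard character of the integers modulo \<open>b\<close>. The argument is an
  integer so that conjugation becomes negation.\<close>

definition additive_char :: "nat \<Rightarrow> int \<Rightarrow> complex" where
  "additive_char b n = cis (2 * pi * of_int n / of_nat b)"

lemma additive_char_exp:
  "exp (2 * of_real pi * \<i> * of_nat n / of_nat b) = additive_char b (int n)"
  "exp (- (2 * of_real pi * \<i> * of_nat n / of_nat b)) = additive_char b (- int n)"
  by (simp_all add: additive_char_def cis_conv_exp mult_ac)

lemma walsh_additive_char: "walsh b k x = additive_char b (int (pairing b k x))"
  by (simp add: walsh_def additive_char_exp)

lemma additive_char_0 [simp]: "additive_char b 0 = 1"
  by (simp add: additive_char_def)

lemma norm_additive_char [simp]: "cmod (additive_char b n) = 1"
  by (simp add: additive_char_def)

lemma additive_char_add: "additive_char b (m + n) = additive_char b m * additive_char b n"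
  by (simp add: additive_char_def cis_mult add_divide_distrib distrib_left)

lemma additive_char_of_nat_mult: "additive_char b (int a * n) = additive_char b n ^ a"
  by (simp add: additive_char_def Complex.DeMoivre mult_ac)

lemma additive_char_mult_base: "0 < b \<Longrightarrow> additive_char b (int b * n) = 1"
  by (simp add: additive_char_def cis_multiple_2pi flip: mult.assoc)

lemma additive_char_cong:
  assumes "0 < b" "[m = n] (mod int b)"
  shows "additive_char b m = additive_char b n"
proof -
  have "[n = m] (mod int b)" using assms(2) by (rule cong_sym)
  then obtain q where "m = n + int b * q"
    by (auto simp: cong_iff_lin)
  then show ?thesis using assms(1) by (simp add: additive_char_add additive_char_mult_base)
qed

lemma additive_char_eq_1:
  assumes "0 < b" "additive_char b n = 1"
  shows "int b dvd n"
proof -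
  obtain q :: int where "2 * pi * of_int n / of_nat b = of_int (2 * q) * pi"
    using assms(2) unfolding additive_char_def cis_conv_exp exp_eq_1 by auto
  then have "of_int n = (of_int (int b * q) :: real)"
    using assms(1) by (simp add: field_simps)
  then show ?thesis unfolding of_int_eq_iff by simp
qed

text \<open>Orthogonality for one digit: a geometric sum over a \<open>b\<close>-th root of unity,
  which vanishes unless the root is 1.\<close>

lemma sum_additive_char:
  assumes "0 < b"
  shows "(\<Sum>a<b. additive_char b (int a * w)) = (if int b dvd w then of_nat b else 0)"
proof (cases "int b dvd w")
  case True
  then obtain q where "w = int b * q" by blast
  then have "additive_char b w = 1" using assms by (simp add: additive_char_mult_base)
  then show ?thesis using True by (simp add: additive_char_of_nat_mult)
next
  case False
  then have "additive_char b w \<noteq> 1" using additive_char_eq_1[OF assms] by blast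
  moreover have "additive_char b w ^ b = 1"
    using assms by (simp add: additive_char_mult_base flip: additive_char_of_nat_mult)
  ultimately show ?thesis
    using False by (simp add: additive_char_of_nat_mult geometric_sum)
qed

text \<open>With \<open>N = b ^ m\<close> this splits off the leading digit of the index, both for
  character sums and for a stage of the transform.\<close>

lemma sum_mult_split:
  fixes q N :: nat
  shows "(\<Sum>i<q * N. g i) = (\<Sum>a<q. \<Sum>i<N. g (i + a * N))"
proof -
  have "(\<Sum>i<q * N. g i) = (\<Sum>a<q. sum g {a * N..<a * N + N})"
    by (rule sum.nat_group[symmetric])
  also have "\<dots> = (\<Sum>a<q. \<Sum>i<N. g (i + a * N))"
  proof (rule sum.cong[OF refl])
    fix a
    show "sum g {a * N..<a * N + N} = (\<Sum>i<N. g (i + a * N))"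
      using sum.shift_bounds_nat_ivl[of g 0 "a * N" N] by (simp add: add.commute lessThan_atLeast0)
  qed
  finally show ?thesis .
qed

text \<open>As \<open>i\<close> runs through all digit vectors, the sum factors into one-digit
  character sums, each equal to \<open>b\<close> or 0.\<close>

lemma sum_additive_char_digits:
  assumes "0 < b"
  shows "(\<Sum>i<b ^ m. additive_char b (\<Sum>l<m. int (ndigit b i l) * w l))
    = (if \<forall>l<m. int b dvd w l then of_nat (b ^ m) else 0)"
proof (induction m)
  case 0
  show ?case by simp
next
  case (Suc m)
  let ?W = "\<lambda>i m. \<Sum>l<m. int (ndigit b i l) * w l"
  have "?W (i + a * b ^ m) (Suc m) = ?W i m + int a * w m" if "i < b ^ m" "a < b" for i a
    using ndigit_add_top[OF that] ndigit_add_low[OF assms] by simp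
  then have "(\<Sum>i<b ^ Suc m. additive_char b (?W i (Suc m)))
      = (\<Sum>a<b. \<Sum>i<b ^ m. additive_char b (?W i m) * additive_char b (int a * w m))"
    by (simp add: sum_mult_split additive_char_add del: sum.lessThan_Suc)
  also have "\<dots> = (\<Sum>i<b ^ m. additive_char b (?W i m)) * (\<Sum>a<b. additive_char b (int a * w m))"
    by (simp add: sum_product sum.swap[of _ "{..<b}"])
  finally show ?case
    using assms by (simp add: Suc.IH sum_additive_char less_Suc_eq)
qed


section \<open>The fast transform\<close>

lemma for_each_append:
  "for_each (xs @ ys) body s = for_each xs body s \<triangleright> for_each ys body"
  by (induction xs arbitrary: s) (simp_all add: and_then_def)

lemma for_each_snoc:
  "fst (for_each (xs @ [x]) body s) = fst (body x (fst (for_each xs body s)))"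
  by (simp add: for_each_append and_then_def)

lemma for_each_accumulate:
  fixes g :: "'a \<Rightarrow> 'b :: comm_monoid_add"
  shows "for_each xs (\<lambda>x s. (s + g x, c)) s = (s + (\<Sum>x\<leftarrow>xs. g x), c * length xs)"
  by (induction xs arbitrary: s) (simp_all add: and_then_def add.assoc)

lemma butterfly_value:
  "fst (butterfly b l A n)
    = (\<Sum>i<b. additive_char b (- int (ndigit b n l * i)) * A ! (n - ndigit b n l * b ^ l + i * b ^ l))
      / of_nat b"
  unfolding butterfly_def Let_def additive_char_exp for_each_accumulate and_then_def
  by (simp add: interv_sum_list_conv_sum_set_nat atLeast0LessThan)

lemma fst_transform_stage:
  "fst (transform_stage b m l A) = map (\<lambda>n. fst (butterfly b l A n)) [0..<b ^ m]"
  by (simp add: transform_stage_def map_costed_def and_then_def)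

text \<open>Loop invariant: after \<open>l\<close> stages the \<open>l\<close> lowest digits of the
  cell index are frequencies, while the higher ones, \<open>n div b ^ l\<close>, still select
  samples. For \<open>l = m\<close> this is the full transform.\<close>

lemma transform_stages:
  assumes b: "0 < b" and ys: "length ys = b ^ m" and "l \<le> m"
  defines "A \<equiv> \<lambda>l. fst (for_each [0..<l] (transform_stage b m) ys)"
  shows "length (A l) = b ^ m \<and> (\<forall>n<b ^ m. A l ! n =
    (\<Sum>i<b ^ l. additive_char b (- (\<Sum>j<l. int (ndigit b n j * ndigit b i j)))
      * ys ! (i + n div b ^ l * b ^ l)) / of_nat (b ^ l))"
  using \<open>l \<le> m\<close>
proof (induction l)
  case 0
  show ?case by (simp add: A_def ys)
next
  case (Suc l)
  then have IH: "A l ! n = (\<Sum>i<b ^ l. additive_char b (- (\<Sum>j<l. int (ndigit b n j * ndigit b i j)))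
      * ys ! (i + n div b ^ l * b ^ l)) / of_nat (b ^ l)" if "n < b ^ m" for n
    using that by simp
  have A_Suc: "A (Suc l) = map (\<lambda>n. fst (butterfly b l (A l) n)) [0..<b ^ m]"
    by (simp add: A_def for_each_snoc fst_transform_stage)
  have "A (Suc l) ! n = (\<Sum>i<b ^ Suc l.
        additive_char b (- (\<Sum>j<Suc l. int (ndigit b n j * ndigit b i j)))
        * ys ! (i + n div b ^ Suc l * b ^ Suc l)) / of_nat (b ^ Suc l)" if n: "n < b ^ m" for n
  proof -
    \<comment> \<open>The index is split into the digits already transformed (\<open>s\<close>), the
      digit now being transformed (\<open>\<nu>\<close>) and the untouched higher digits
      (\<open>q\<close>).\<close>
    define \<nu> where "\<nu> = ndigit b n l"
    define s where "s = n mod b ^ l"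
    define q where "q = n div b ^ Suc l"
    have s: "s < b ^ l" using b by (simp add: s_def)
    have "q = n div b ^ l div b" by (simp only: q_def power_Suc2 div_mult2_eq)
    then have ql: "n div b ^ l = \<nu> + q * b"
      by (simp add: \<nu>_def ndigit_def)
    then have n_eq: "n = s + (\<nu> + q * b) * b ^ l"
      by (metis s_def mod_mult_div_eq add.commute mult.commute)
    have cell: "n - \<nu> * b ^ l + i * b ^ l = s + (i + q * b) * b ^ l" for i
      unfolding n_eq by (simp add: algebra_simps)
    \<comment> \<open>All cells with the same \<open>s\<close> and \<open>q\<close> as
      \<open>n\<close> must lie inside the array for the induction hypothesis to apply to each cell
      that the butterfly reads.\<close>
    have "q * b ^ Suc l \<le> n" by (simp add: q_def)
    then have "q * b ^ Suc l < b ^ (m - Suc l) * b ^ Suc l"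
      using n Suc.prems by (simp flip: power_add del: power_Suc)
    then have "Suc q \<le> b ^ (m - Suc l)" by (simp del: power_Suc)
    then have "Suc q * b ^ Suc l \<le> b ^ (m - Suc l) * b ^ Suc l" by (rule mult_le_mono1)
    then have q: "Suc q * b ^ Suc l \<le> b ^ m"
      using Suc.prems by (simp flip: power_add del: power_Suc mult_Suc)
    have cell_less: "s + (i + q * b) * b ^ l < b ^ m" if "i < b" for i
    proof -
      have "s + i * b ^ l < b ^ Suc l" using add_top_digit_less[OF s that] .
      then have "s + (i + q * b) * b ^ l < Suc q * b ^ Suc l" by (simp add: algebra_simps)
      then show ?thesis using q by linarith
    qed
    have cell_digit: "ndigit b (s + r * b ^ l) j = ndigit b n j" if "j < l" for r j
      by (simp add: n_eq ndigit_add_low[OF b that])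
    have cell_div: "(s + r * b ^ l) div b ^ l = r" for r
      using s b by simp
    have "A l ! (n - \<nu> * b ^ l + a * b ^ l)
        = (\<Sum>i<b ^ l. additive_char b (- (\<Sum>j<l. int (ndigit b n j * ndigit b i j)))
            * ys ! (i + (a + q * b) * b ^ l)) / of_nat (b ^ l)" if "a < b" for a
      unfolding cell IH[OF cell_less[OF that]] cell_div using cell_digit by simp
    then have "A (Suc l) ! n = (\<Sum>a<b. additive_char b (- int (\<nu> * a)) *
        ((\<Sum>i<b ^ l. additive_char b (- (\<Sum>j<l. int (ndigit b n j * ndigit b i j)))
            * ys ! (i + (a + q * b) * b ^ l)) / of_nat (b ^ l))) / of_nat b"
      using n by (simp add: A_Suc butterfly_value \<nu>_def)
    also have "\<dots> = (\<Sum>a<b. \<Sum>i<b ^ l. additive_char b (- int (\<nu> * a)) *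
        (additive_char b (- (\<Sum>j<l. int (ndigit b n j * ndigit b i j)))
            * ys ! (i + (a + q * b) * b ^ l))) / of_nat (b ^ Suc l)"
      by (simp add: sum_distrib_left sum_divide_distrib mult.commute)
    \<comment> \<open>The outer index \<open>a\<close> becomes digit \<open>l\<close> of the
      combined index \<open>i + a * b ^ l\<close>, contributing the summand \<open>j = l\<close> of
      the exponent.\<close>
    also have "(\<Sum>a<b. \<Sum>i<b ^ l. additive_char b (- int (\<nu> * a)) *
        (additive_char b (- (\<Sum>j<l. int (ndigit b n j * ndigit b i j)))
            * ys ! (i + (a + q * b) * b ^ l)))
        = (\<Sum>a<b. \<Sum>i<b ^ l.
        additive_char b (- (\<Sum>j<Suc l. int (ndigit b n j * ndigit b (i + a * b ^ l) j)))
        * ys ! ((i + a * b ^ l) + q * b ^ Suc l))"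
    proof (intro sum.cong refl)
      fix a i
      assume "a \<in> {..<b}" "i \<in> {..<b ^ l}"
      then have "(\<Sum>j<Suc l. int (ndigit b n j * ndigit b (i + a * b ^ l) j))
          = int (\<nu> * a) + (\<Sum>j<l. int (ndigit b n j * ndigit b i j))"
        using ndigit_add_top[of i b l a] ndigit_add_low[OF b] by (simp add: \<nu>_def)
      moreover have "i + (a + q * b) * b ^ l = (i + a * b ^ l) + q * b ^ Suc l"
        by (simp add: algebra_simps)
      ultimately show "additive_char b (- int (\<nu> * a)) *
          (additive_char b (- (\<Sum>j<l. int (ndigit b n j * ndigit b i j)))
            * ys ! (i + (a + q * b) * b ^ l))
          = additive_char b (- (\<Sum>j<Suc l. int (ndigit b n j * ndigit b (i + a * b ^ l) j)))
            * ys ! ((i + a * b ^ l) + q * b ^ Suc l)"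
        by (simp only: minus_add_distrib additive_char_add mult.assoc)
    qed
    also have "\<dots> = (\<Sum>i<b ^ Suc l.
        additive_char b (- (\<Sum>j<Suc l. int (ndigit b n j * ndigit b i j)))
        * ys ! (i + q * b ^ Suc l))"
      by (simp only: sum_mult_split power_Suc)
    finally show ?thesis by (simp only: q_def)
  qed
  then show ?case by (simp add: A_Suc)
qed

lemma nu_tilde_less: "0 < b \<Longrightarrow> nu_tilde b z m k < b ^ m"
  unfolding nu_tilde_def by (intro digit_sum_less pairing_less)

lemma ndigit_nu_tilde: "0 < b \<Longrightarrow> j < m \<Longrightarrow> ndigit b (nu_tilde b z m k) j = pairing b k (z (b ^ j))"
  unfolding nu_tilde_def by (subst ndigit_digit_sum) (simp_all add: pairing_less)

text \<open>The digits of \<open>nu_tilde b z m k\<close> are the pairings of \<open>k\<close> with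
  the generators, so the exponent in that cell is congruent to the pairing of \<open>k\<close> with
  \<open>z i\<close>.\<close>

lemma fast_transform_nu_tilde:
  assumes b: "1 < b" and z: "digital_sequence b z"
  shows "fst (fast_transform b m (map y [0..<b ^ m])) ! nu_tilde b z m k
    = (\<Sum>i<b ^ m. additive_char b (- int (pairing b k (z i))) * y i) / of_nat (b ^ m)"
proof -
  have b0: "0 < b" using b by simp
  have "additive_char b (- (\<Sum>j<m. int (ndigit b (nu_tilde b z m k) j * ndigit b i j)))
      = additive_char b (- int (pairing b k (z i)))" if i: "i < b ^ m" for i
  proof (rule additive_char_cong[OF b0])
    have "(\<Sum>j<m. int (ndigit b (nu_tilde b z m k) j * ndigit b i j))
        = int (\<Sum>j<m. ndigit b i j * pairing b k (z (b ^ j)))"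
      by (simp add: ndigit_nu_tilde[OF b0] mult.commute)
    moreover have "[int (pairing b k (z i))
        = int (\<Sum>j<m. ndigit b i j * pairing b k (z (b ^ j)))] (mod int b)"
      using pairing_digital_sequence[OF b z i] by (simp only: cong_int_iff)
    ultimately show "[- (\<Sum>j<m. int (ndigit b (nu_tilde b z m k) j * ndigit b i j))
        = - int (pairing b k (z i))] (mod int b)"
      by (simp add: cong_minus_minus_iff cong_sym_eq)
  qed
  then show ?thesis
    using transform_stages[OF b0, of "map y [0..<b ^ m]" m m] nu_tilde_less[OF b0, of z m k]
    by (simp add: fast_transform_def)
qed


section \<open>Aliasing\<close>

lemma has_sum_finite_sum:
  fixes g :: "'i \<Rightarrow> 'a \<Rightarrow> 'b :: {comm_monoid_add, topological_comm_monoid_add}"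
  assumes "finite I" "\<And>i. i \<in> I \<Longrightarrow> (g i has_sum s i) A"
  shows "((\<lambda>x. \<Sum>i\<in>I. g i x) has_sum (\<Sum>i\<in>I. s i)) A"
  using assms
proof (induction I)
  case (insert i I)
  then have "((\<lambda>x. g i x + (\<Sum>i\<in>I. g i x)) has_sum (s i + (\<Sum>i\<in>I. s i))) A"
    by (intro has_sum_add) auto
  then show ?case using insert.hyps by simp
qed simp

text \<open>The Walsh series is inserted at every point and the finite sum is taken inside. The
  shift contributes only the factor \<open>walsh b \<kappa> \<Delta>\<close>; averaging the
  remaining characters over the points removes every \<kappa> that some generator distinguishes from
  \<open>k\<close>.\<close>

lemma aliasing:
  assumes b: "1 < b" and z: "digital_sequence b z" and ok: "\<And>i. ok b (z i) \<Delta>"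
    and ser: "\<And>i. equals_walsh_series_at b f (dplus b (z i) \<Delta>)"
  shows "((\<lambda>\<kappa>. if \<forall>l<m. pairing b \<kappa> (z (b ^ l)) = pairing b k (z (b ^ l))
        then walsh_coeff b f \<kappa> * walsh b \<kappa> \<Delta> else 0)
    has_sum (\<Sum>i<b ^ m. additive_char b (- int (pairing b k (z i))) * f (dplus b (z i) \<Delta>))
      / of_nat (b ^ m)) UNIV" (is "(?g has_sum _) UNIV")
proof -
  have b0: "0 < b" using b by simp
  let ?c = "walsh_coeff b f"
  have "((\<lambda>\<kappa>. \<Sum>i<b ^ m. additive_char b (- int (pairing b k (z i))) *
        (?c \<kappa> * walsh b \<kappa> (dplus b (z i) \<Delta>)))
      has_sum (\<Sum>i<b ^ m. additive_char b (- int (pairing b k (z i))) * f (dplus b (z i) \<Delta>))) UNIV"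
    using ser unfolding equals_walsh_series_at_def
    by (intro has_sum_finite_sum has_sum_cmult_right) auto
  then have "((\<lambda>\<kappa>. inverse (of_nat (b ^ m)) *
        (\<Sum>i<b ^ m. additive_char b (- int (pairing b k (z i))) *
        (?c \<kappa> * walsh b \<kappa> (dplus b (z i) \<Delta>))))
      has_sum (inverse (of_nat (b ^ m)) *
        (\<Sum>i<b ^ m. additive_char b (- int (pairing b k (z i))) * f (dplus b (z i) \<Delta>)))) UNIV"
    by (rule has_sum_cmult_right)
  moreover have "inverse (of_nat (b ^ m)) *
        (\<Sum>i<b ^ m. additive_char b (- int (pairing b k (z i))) *
        (?c \<kappa> * walsh b \<kappa> (dplus b (z i) \<Delta>))) = ?g \<kappa>" for \<kappa>
  proof -
    define w where "w l = int (pairing b \<kappa> (z (b ^ l))) - int (pairing b k (z (b ^ l)))" for l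
    \<comment> \<open>Both pairings are below \<open>b\<close>, so congruence is equality.\<close>
    have dvd: "int b dvd w l \<longleftrightarrow> pairing b \<kappa> (z (b ^ l)) = pairing b k (z (b ^ l))" for l
    proof
      assume "int b dvd w l"
      then have "[pairing b \<kappa> (z (b ^ l)) = pairing b k (z (b ^ l))] (mod b)"
        by (simp add: w_def cong_iff_dvd_diff flip: cong_int_iff)
      then show "pairing b \<kappa> (z (b ^ l)) = pairing b k (z (b ^ l))"
        by (simp add: cong_def pairing_less[OF b0])
    qed (simp add: w_def)
    have "additive_char b (- int (pairing b k (z i))) * (?c \<kappa> * walsh b \<kappa> (dplus b (z i) \<Delta>))
        = ?c \<kappa> * walsh b \<kappa> \<Delta> * additive_char b (\<Sum>l<m. int (ndigit b i l) * w l)"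
      if i: "i < b ^ m" for i
    proof -
      have *: "[int (pairing b k (z i)) = int (\<Sum>l<m. ndigit b i l * pairing b k (z (b ^ l)))] (mod int b)" for k
        using pairing_digital_sequence[OF b z i] by (simp only: cong_int_iff)
      have w: "int (\<Sum>l<m. ndigit b i l * pairing b \<kappa> (z (b ^ l)))
          - int (\<Sum>l<m. ndigit b i l * pairing b k (z (b ^ l))) = (\<Sum>l<m. int (ndigit b i l) * w l)"
        by (simp add: w_def right_diff_distrib sum_subtractf)
      have "[int (pairing b \<kappa> (dplus b (z i) \<Delta>)) = int (pairing b \<kappa> (z i) + pairing b \<kappa> \<Delta>)] (mod int b)"
        using pairing_dplus[OF b ok] by (simp only: cong_int_iff)
      then have "[int (pairing b \<kappa> (dplus b (z i) \<Delta>)) - int (pairing b k (z i))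
          = int (pairing b \<kappa> (z i) + pairing b \<kappa> \<Delta>) - int (pairing b k (z i))] (mod int b)"
        by (rule cong_diff[OF _ cong_refl])
      also have "int (pairing b \<kappa> (z i) + pairing b \<kappa> \<Delta>) - int (pairing b k (z i))
          = int (pairing b \<kappa> \<Delta>) + (int (pairing b \<kappa> (z i)) - int (pairing b k (z i)))" by simp
      also have "[\<dots> = int (pairing b \<kappa> \<Delta>) + (\<Sum>l<m. int (ndigit b i l) * w l)] (mod int b)"
        unfolding w[symmetric] by (intro cong_add cong_refl cong_diff *)
      finally have "additive_char b (- int (pairing b k (z i)) + int (pairing b \<kappa> (dplus b (z i) \<Delta>)))
          = additive_char b (int (pairing b \<kappa> \<Delta>) + (\<Sum>l<m. int (ndigit b i l) * w l))"
        by (intro additive_char_cong[OF b0]) simp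
      then show ?thesis
        unfolding additive_char_add by (simp add: walsh_additive_char mult_ac)
    qed
    then have "(\<Sum>i<b ^ m. additive_char b (- int (pairing b k (z i))) *
        (?c \<kappa> * walsh b \<kappa> (dplus b (z i) \<Delta>)))
        = ?c \<kappa> * walsh b \<kappa> \<Delta> * (\<Sum>i<b ^ m. additive_char b (\<Sum>l<m. int (ndigit b i l) * w l))"
      unfolding sum_distrib_left by (intro sum.cong refl) (simp only: lessThan_iff)
    then show ?thesis
      using b0 by (auto simp add: sum_additive_char_digits[OF b0] dvd)
  qed
  ultimately show ?thesis by (simp only: divide_inverse_commute)
qed


section \<open>Wavenumber maps\<close>

text \<open>Congruence modulo the dual net of level \<open>m\<close>, tested on the generators; this
  is the condition that selects the terms in \<open>aliasing\<close>.\<close>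

definition agree :: "nat \<Rightarrow> (nat \<Rightarrow> real ^ 'd) \<Rightarrow> nat \<Rightarrow> nat ^ 'd \<Rightarrow> nat ^ 'd \<Rightarrow> bool" where
  "agree b z m k k' \<longleftrightarrow> (\<forall>l<m. pairing b k (z (b ^ l)) = pairing b k' (z (b ^ l)))"

lemma agree_trans: "agree b z m k k' \<Longrightarrow> agree b z m k' k'' \<Longrightarrow> agree b z m k k''"
  by (simp add: agree_def)

lemma agree_sym: "agree b z m k k' \<Longrightarrow> agree b z m k' k"
  by (simp add: agree_def)

lemma agree_mono: "agree b z m k k' \<Longrightarrow> n \<le> m \<Longrightarrow> agree b z n k k'"
  by (simp add: agree_def)

text \<open>The permutation \<open>\<pi>\<close> is extended by \<open>\<pi> 0 = 0\<close> here.\<close>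

lemma wavenumber_map_digit:
  assumes b: "1 < b" and kt: "wavenumber_map b z kt" and \<kappa>: "\<kappa> < b ^ m"
  obtains \<pi> where "inj_on \<pi> {..<b}" "\<pi> ` {..<b} \<subseteq> {..<b}" "\<And>a. a < b \<Longrightarrow> agree b z m (kt (\<kappa> + a * b ^ m)) (kt \<kappa>)"
    "\<And>a. a < b \<Longrightarrow> [pairing b (kt (\<kappa> + a * b ^ m)) (z (b ^ m)) = \<pi> a + pairing b (kt \<kappa>) (z (b ^ m))] (mod b)"
proof -
  obtain \<pi> where bij: "bij_betw \<pi> {1..<b} {1..<b}"
    and dual: "\<And>a. a \<in> {1..<b} \<Longrightarrow> kminus b (kt (\<kappa> + a * b ^ m)) (kt \<kappa>) \<in> dual_net b z m"
    and pair: "\<And>a. a \<in> {1..<b} \<Longrightarrow> pairing b (kminus b (kt (\<kappa> + a * b ^ m)) (kt \<kappa>)) (z (b ^ m)) = \<pi> a"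
    using kt \<kappa> unfolding wavenumber_map_def mem_Collect_eq by meson
  define \<pi>' where "\<pi>' = \<pi>(0 := 0)"
  have split: "{..<b} = insert 0 {1..<b}" using b by auto
  have b0: "0 < b" using b by simp
  show thesis
  proof
    have "inj_on \<pi>' {1..<b}" and im: "\<pi>' ` {1..<b} = {1..<b}"
      using bij by (auto simp: \<pi>'_def bij_betw_def inj_on_def)
    then show "inj_on \<pi>' {..<b}" unfolding split by (simp add: \<pi>'_def)
    show "\<pi>' ` {..<b} \<subseteq> {..<b}"
      unfolding split image_insert im by (simp add: \<pi>'_def)
    show "agree b z m (kt (\<kappa> + a * b ^ m)) (kt \<kappa>)" if "a < b" for a
    proof (cases "a = 0")
      case False
      then have a: "a \<in> {1..<b}" using that by simp
      show ?thesis
        unfolding agree_def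
      proof (intro allI impI)
        fix l assume "l < m"
        \<comment> \<open>Hence \<open>z (b ^ l)\<close> is among the points that define the dual
          net of level \<open>m\<close>.\<close>
        then have "b ^ l < b ^ m" using b by simp
        then have "pairing b (kminus b (kt (\<kappa> + a * b ^ m)) (kt \<kappa>)) (z (b ^ l)) = 0"
          using dual[OF a] by (simp add: dual_net_def)
        then have "[pairing b (kt \<kappa>) (z (b ^ l)) = pairing b (kt (\<kappa> + a * b ^ m)) (z (b ^ l))] (mod b)"
          using pairing_kminus[OF b, of "kt (\<kappa> + a * b ^ m)" "kt \<kappa>" "z (b ^ l)"] by simp
        then show "pairing b (kt (\<kappa> + a * b ^ m)) (z (b ^ l)) = pairing b (kt \<kappa>) (z (b ^ l))"
          by (simp add: cong_def pairing_less[OF b0])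
      qed
    qed (simp add: agree_def)
    show "[pairing b (kt (\<kappa> + a * b ^ m)) (z (b ^ m)) = \<pi>' a + pairing b (kt \<kappa>) (z (b ^ m))] (mod b)"
      if "a < b" for a
    proof (cases "a = 0")
      case False
      then have a: "a \<in> {1..<b}" using that by simp
      then show ?thesis
        using pairing_kminus[OF b, of "kt (\<kappa> + a * b ^ m)" "kt \<kappa>" "z (b ^ m)"] pair[OF a]
        by (simp add: \<pi>'_def cong_sym_eq)
    qed (simp add: \<pi>'_def)
  qed
qed

text \<open>Deleting a leading digit at a position \<open>n \<ge> m\<close> moves
  \<open>kt \<kappa>\<close> by an element of the dual net of level \<open>n\<close>, which
  preserves the pairings with the first \<open>m\<close> generators. Repeated deletion ends at
  \<open>\<kappa> mod b ^ m\<close>.\<close>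

lemma wavenumber_map_agree_mod:
  assumes b: "1 < b" and kt: "wavenumber_map b z kt"
  shows "agree b z m (kt \<kappa>) (kt (\<kappa> mod b ^ m))"
proof -
  have "agree b z m (kt \<kappa>) (kt (\<kappa> mod b ^ m))" if "\<kappa> < b ^ n" for n
    using that
  proof (induction n arbitrary: \<kappa>)
    case 0
    then show ?case by (simp add: agree_def)
  next
    case (Suc n)
    show ?case
    proof (cases "n < m")
      case True
      then have "b ^ Suc n \<le> b ^ m" using b by (intro power_increasing) auto
      then have "\<kappa> mod b ^ m = \<kappa>" using Suc.prems by simp
      then show ?thesis by (simp add: agree_def)
    next
      case False
      define \<rho> where "\<rho> = \<kappa> mod b ^ n"
      define a where "a = \<kappa> div b ^ n"
      have \<kappa>: "\<kappa> = \<rho> + a * b ^ n" by (simp only: \<rho>_def a_def mod_div_mult_eq)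
      have \<rho>: "\<rho> < b ^ n" and a: "a < b"
        using b Suc.prems by (auto simp: \<rho>_def a_def less_mult_imp_div_less)
      obtain \<pi> where "agree b z n (kt (\<rho> + a * b ^ n)) (kt \<rho>)"
        using wavenumber_map_digit[OF b kt \<rho>] a by blast
      then have "agree b z m (kt \<kappa>) (kt \<rho>)"
        unfolding \<kappa> by (rule agree_mono) (use False in simp)
      moreover have "agree b z m (kt \<rho>) (kt (\<rho> mod b ^ m))" using Suc.IH[OF \<rho>] .
      moreover have "\<rho> mod b ^ m = \<kappa> mod b ^ m"
        unfolding \<rho>_def using False by (intro mod_mod_cancel le_imp_power_dvd) simp
      ultimately show ?thesis by (metis agree_trans)
    qed
  qed
  moreover have "\<kappa> < b ^ \<kappa>" using b by (simp add: power_gt_expt)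
  ultimately show ?thesis by blast
qed

text \<open>For the forward direction, two indices with the same remainder modulo
  \<open>b ^ m\<close> are told apart in digit \<open>m\<close> by the pairing with
  \<open>z (b ^ m)\<close>, because the permutation \<pi> is injective.\<close>

lemma wavenumber_map_agree_iff:
  assumes b: "1 < b" and kt: "wavenumber_map b z kt"
  shows "agree b z m (kt \<kappa>) (kt \<kappa>') \<longleftrightarrow> \<kappa> mod b ^ m = \<kappa>' mod b ^ m"
proof
  assume eq: "\<kappa> mod b ^ m = \<kappa>' mod b ^ m"
  show "agree b z m (kt \<kappa>) (kt \<kappa>')"
    using wavenumber_map_agree_mod[OF b kt, of m \<kappa>] wavenumber_map_agree_mod[OF b kt, of m \<kappa>']
    unfolding eq by (metis agree_trans agree_sym)
next
  assume "agree b z m (kt \<kappa>) (kt \<kappa>')"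
  then show "\<kappa> mod b ^ m = \<kappa>' mod b ^ m"
  proof (induction m)
    case 0
    show ?case by simp
  next
    case (Suc m)
    define \<rho> where "\<rho> = \<kappa> mod b ^ m"
    have \<rho>: "\<rho> < b ^ m" using b by (simp add: \<rho>_def)
    have \<rho>': "\<kappa>' mod b ^ m = \<rho>"
      using Suc.IH agree_mono[OF Suc.prems, of m] by (simp add: \<rho>_def)
    have digit: "\<exists>a<b. \<kappa> mod b ^ Suc m = \<rho> + a * b ^ m" if "\<kappa> mod b ^ m = \<rho>" for \<kappa>
    proof (intro exI conjI)
      show "\<kappa> div b ^ m mod b < b" using b by simp
      show "\<kappa> mod b ^ Suc m = \<rho> + \<kappa> div b ^ m mod b * b ^ m"
        unfolding that[symmetric] power_Suc2 mod_mult2_eq by simp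
    qed
    obtain a where a: "a < b" "\<kappa> mod b ^ Suc m = \<rho> + a * b ^ m"
      using digit[of \<kappa>] \<rho>_def by blast
    obtain a' where a': "a' < b" "\<kappa>' mod b ^ Suc m = \<rho> + a' * b ^ m"
      using digit[OF \<rho>'] by blast
    obtain \<pi> where \<pi>: "inj_on \<pi> {..<b}" "\<pi> ` {..<b} \<subseteq> {..<b}"
      and pair: "\<And>a. a < b \<Longrightarrow>
        [pairing b (kt (\<rho> + a * b ^ m)) (z (b ^ m)) = \<pi> a + pairing b (kt \<rho>) (z (b ^ m))] (mod b)"
      using wavenumber_map_digit[OF b kt \<rho>] by metis
    have "agree b z (Suc m) (kt (\<kappa> mod b ^ Suc m)) (kt (\<kappa>' mod b ^ Suc m))"
      using Suc.prems wavenumber_map_agree_mod[OF b kt] by (metis agree_trans agree_sym)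
    then have "pairing b (kt (\<rho> + a * b ^ m)) (z (b ^ m)) = pairing b (kt (\<rho> + a' * b ^ m)) (z (b ^ m))"
      unfolding a(2) a'(2) by (simp add: agree_def)
    then have "[\<pi> a + pairing b (kt \<rho>) (z (b ^ m)) = \<pi> a' + pairing b (kt \<rho>) (z (b ^ m))] (mod b)"
      using pair[OF a(1)] pair[OF a'(1)] by (metis cong_def)
    then have "[\<pi> a = \<pi> a'] (mod b)" by (simp add: cong_add_rcancel_nat)
    moreover have "\<pi> a < b" "\<pi> a' < b" using \<pi>(2) a(1) a'(1) by auto
    ultimately have "\<pi> a = \<pi> a'" by (simp add: cong_def)
    then have "a = a'" using \<pi>(1) a(1) a'(1) by (simp add: inj_on_def)
    then show ?case using a a' by simp
  qed
qed

text \<open>Equal wavenumbers agree at every level, in particular at one so high that both indices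
  are their own remainders.\<close>

lemma wavenumber_map_inj:
  assumes b: "1 < b" and kt: "wavenumber_map b z kt"
  shows "inj kt"
proof (rule injI)
  fix \<kappa> \<kappa>' assume "kt \<kappa> = kt \<kappa>'"
  then have "agree b z (\<kappa> + \<kappa>') (kt \<kappa>) (kt \<kappa>')" by (simp add: agree_def)
  moreover have "\<kappa> < b ^ (\<kappa> + \<kappa>')" "\<kappa>' < b ^ (\<kappa> + \<kappa>')"
    using power_gt_expt[of b "\<kappa> + \<kappa>'"] b by linarith+
  ultimately show "\<kappa> = \<kappa>'" by (simp add: wavenumber_map_agree_iff[OF b kt])
qed


section \<open>Cost of the levels\<close>

lemma for_each_cost_le:
  assumes "\<And>x s. x \<in> set xs \<Longrightarrow> snd (body x s) \<le> c x"
  shows "snd (for_each xs body s) \<le> (\<Sum>x\<leftarrow>xs. c x)"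
  using assms
proof (induction xs arbitrary: s)
  case (Cons x xs)
  then show ?case by (simp add: and_then_def add_mono)
qed simp

text \<open>Per cell: \<open>2 * b\<close> for the accumulation, one division, one write.\<close>

lemma transform_stage_cost: "snd (transform_stage b m l A) = b ^ m * (2 * b + 2)"
proof -
  have "snd (butterfly b l A n) = 2 * b + 1" for n
    by (simp add: butterfly_def Let_def and_then_def for_each_accumulate)
  then show ?thesis
    by (simp add: transform_stage_def map_costed_def and_then_def sum_list_triv)
qed

lemma fast_transform_cost: "snd (fast_transform b m ys) \<le> m * (b ^ m * (2 * b + 2))"
  unfolding fast_transform_def
  using for_each_cost_le[of "[0..<m]" "transform_stage b m" "\<lambda>_. b ^ m * (2 * b + 2)" ys]
  by (simp add: transform_stage_cost sum_list_triv)

lemma sum_powers_le: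
  fixes b :: nat
  assumes "1 < b"
  shows "(\<Sum>l<m. b ^ l) \<le> b ^ m"
proof (induction m)
  case (Suc m)
  have "2 * b ^ m \<le> b * b ^ m" using assms by (intro mult_le_mono1) simp
  then have "b ^ m + b ^ m \<le> b ^ Suc m" by (simp only: mult_2 power_Suc)
  then show ?case using Suc unfolding sum.lessThan_Suc by linarith
qed simp

text \<open>The swaps at all \<open>l < m\<close> form a geometric sum, so there is no factor
  \<open>m\<close> here; that factor comes from the transform alone.\<close>

lemma pointer_algorithm_cost:
  assumes b: "1 < b"
  shows "snd (pointer_algorithm b r sel m Y \<nu>) \<le> (2 * b + 4) * b ^ m"
proof -
  let ?swaps = "for_each (rev [max 1 (m - r)..<m]) (\<lambda>l.
             for_each [1..<b ^ l] (\<lambda>\<kappa>. swap_step b sel m Y l \<kappa>))"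
  have inner: "snd (for_each [1..<b ^ l] (\<lambda>\<kappa>. swap_step b sel m Y l \<kappa>) s) \<le> (2 * b + 1) * b ^ l" for l s
  proof -
    have "snd (for_each [1..<b ^ l] (\<lambda>\<kappa>. swap_step b sel m Y l \<kappa>) s)
        \<le> (\<Sum>\<kappa>\<leftarrow>[1..<b ^ l]. 2 * b + 1)"
      by (rule for_each_cost_le) (simp add: swap_step_def Let_def)
    also have "\<dots> = (2 * b + 1) * (b ^ l - 1)" by (simp only: sum_list_triv length_upt of_nat_id mult.commute)
    also have "\<dots> \<le> (2 * b + 1) * b ^ l" by (rule mult_le_mono2) simp
    finally show ?thesis .
  qed
  have swaps: "snd (?swaps s) \<le> (2 * b + 1) * b ^ m" for s
  proof -
    have "snd (?swaps s) \<le> (\<Sum>l\<leftarrow>rev [max 1 (m - r)..<m]. (2 * b + 1) * b ^ l)"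
      by (rule for_each_cost_le) (rule inner)
    also have "\<dots> = (\<Sum>l\<in>{max 1 (m - r)..<m}. (2 * b + 1) * b ^ l)"
      by (simp only: interv_sum_list_conv_sum_set_nat rev_map[symmetric] sum_list_rev set_upt)
    also have "\<dots> \<le> (\<Sum>l<m. (2 * b + 1) * b ^ l)" by (rule sum_mono2) auto
    also have "\<dots> \<le> (2 * b + 1) * b ^ m"
      unfolding sum_distrib_left[symmetric] by (rule mult_le_mono2[OF sum_powers_le[OF b]])
    finally show ?thesis .
  qed
  have "b ^ (m - r) \<le> b ^ m" using b by (intro power_increasing) auto
  then have length: "length [b ^ (m - r) div b..<b ^ (m - r)] \<le> b ^ m" by simp
  show ?thesis
  proof (cases "m = 0")
    case True
    then show ?thesis
      using length b by (simp add: pointer_algorithm_def and_then_def for_each_accumulate)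
  next
    case False
    \<comment> \<open>The three terms are the initialization, the swaps and the returned
      sum.\<close>
    have "snd (pointer_algorithm b r sel m Y \<nu>) \<le> b ^ m + (2 * b + 1) * b ^ m + 2 * b ^ m"
      unfolding pointer_algorithm_def and_then_def for_each_accumulate
      using False length swaps[of "\<nu> @ [b ^ (m - 1)..<b ^ m]"]
      by (auto simp del: length_upt)
    also have "\<dots> = (2 * b + 4) * b ^ m" by (simp add: algebra_simps)
    finally show ?thesis .
  qed
qed

lemma level_step_cost:
  assumes "1 < b"
  shows "snd (level_step b r sel ys m \<nu>) \<le> (2 * b + 4) * Suc m * b ^ m"
proof -
  have "snd (level_step b r sel ys m \<nu>) \<le> m * (b ^ m * (2 * b + 2)) + (2 * b + 4) * b ^ m"
    unfolding level_step_def and_then_def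
    using fast_transform_cost pointer_algorithm_cost[OF assms] by (simp add: add_mono)
  also have "\<dots> \<le> (2 * b + 4) * Suc m * b ^ m"
    by (simp add: algebra_simps)
  finally show ?thesis .
qed

text \<open>With the linear factor bounded by \<open>M\<close>, the costs of the levels again form a
  geometric sum.\<close>

lemma levels_below_cost:
  assumes b: "1 < b"
  shows "snd (levels_below b r sel ys M) \<le> (2 * b + 4) * M * b ^ M"
proof -
  have "snd (levels_below b r sel ys M) \<le> (\<Sum>m\<leftarrow>[0..<M]. (2 * b + 4) * M * b ^ m)"
    unfolding levels_below_def
  proof (rule for_each_cost_le)
    fix m \<nu> assume "m \<in> set [0..<M]"
    then have m: "Suc m \<le> M" by simp
    have "snd (level_step b r sel ys m \<nu> \<triangleright> (\<lambda>(\<nu>', S). (\<nu>', 0))) \<le> (2 * b + 4) * Suc m * b ^ m"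
      using level_step_cost[OF b] by (simp add: and_then_def split_def)
    also have "\<dots> \<le> (2 * b + 4) * M * b ^ m"
      by (intro mult_le_mono1 mult_le_mono2 m)
    finally show "snd (level_step b r sel ys m \<nu> \<triangleright> (\<lambda>(\<nu>', S). (\<nu>', 0))) \<le> (2 * b + 4) * M * b ^ m" .
  qed
  also have "\<dots> = (2 * b + 4) * M * (\<Sum>m<M. b ^ m)"
    by (simp only: interv_sum_list_conv_sum_set_nat set_upt sum_distrib_left lessThan_atLeast0)
  also have "\<dots> \<le> (2 * b + 4) * M * b ^ M"
    by (rule mult_le_mono2[OF sum_powers_le[OF b]])
  finally show ?thesis .
qed


section \<open>Results of the levels\<close>

lemma level_step_sum:
  assumes "r \<le> m"
  shows "snd (fst (level_step b r sel ys m \<nu>)) = Some (\<Sum>\<kappa>\<in>block b (m - r).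
    cmod (fst (fast_transform b m (take (b ^ m) ys)) ! (fst (fst (level_step b r sel ys m \<nu>)) ! \<kappa>)))"
  using assms
  by (simp add: level_step_def pointer_algorithm_def and_then_def for_each_accumulate block_def
      interv_sum_list_conv_sum_set_nat)

lemma level_step_take:
  "take (b ^ m) ys = take (b ^ m) ys' \<Longrightarrow> level_step b r sel ys m \<nu> = level_step b r sel ys' m \<nu>"
  by (simp add: level_step_def)

lemma levels_below_Suc:
  "fst (levels_below b r sel ys (Suc M)) = fst (fst (level_step b r sel ys M (fst (levels_below b r sel ys M))))"
  by (simp add: levels_below_def for_each_snoc and_then_def split_def)

text \<open>Level \<open>m\<close> reads only the first \<open>b ^ m\<close> values, so the pointers
  do not depend on how many values are stored beyond these.\<close>

lemma levels_below_take:
  assumes "\<And>m. m < M \<Longrightarrow> take (b ^ m) ys = take (b ^ m) ys'"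
  shows "fst (levels_below b r sel ys M) = fst (levels_below b r sel ys' M)"
  using assms
proof (induction M)
  case 0
  show ?case by (simp add: levels_below_def)
next
  case (Suc M)
  then show ?case by (simp add: levels_below_Suc level_step_take[of b M ys ys'])
qed

text \<open>The pointer list with which a run enters level \<open>m\<close>, whichever level it started from.\<close>

definition entering :: "nat \<Rightarrow> nat \<Rightarrow> selection_rule \<Rightarrow> (nat \<Rightarrow> complex) \<Rightarrow> nat \<Rightarrow> nat list" where
  "entering b r sel y m = fst (levels_below b r sel (map y [0..<b ^ m]) m)"

definition level_result ::
  "nat \<Rightarrow> nat \<Rightarrow> selection_rule \<Rightarrow> (nat \<Rightarrow> complex) \<Rightarrow> nat \<Rightarrow> (nat list \<times> real option) costed" where
  "level_result b r sel y m = level_step b r sel (map y [0..<b ^ m]) m (entering b r sel y m)"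

text \<open>By \<open>level_step_sum\<close> the option is \<open>Some\<close> whenever
  \<open>r \<le> m\<close>, hence at every level tested in a run.\<close>

definition level_sum :: "nat \<Rightarrow> nat \<Rightarrow> selection_rule \<Rightarrow> (nat \<Rightarrow> complex) \<Rightarrow> nat \<Rightarrow> real" where
  "level_sum b r sel y m = the (snd (fst (level_result b r sel y m)))"

lemma level_result_Suc:
  assumes "1 < b"
  shows "fst (levels_below b r sel (map y [0..<b ^ m]) (Suc m)) = fst (fst (level_result b r sel y m))"
    and "entering b r sel y (Suc m) = fst (fst (level_result b r sel y m))"
proof -
  show *: "fst (levels_below b r sel (map y [0..<b ^ m]) (Suc m)) = fst (fst (level_result b r sel y m))"
    by (simp add: levels_below_Suc level_result_def entering_def)
  have "fst (levels_below b r sel (map y [0..<b ^ Suc m]) (Suc m))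
      = fst (levels_below b r sel (map y [0..<b ^ m]) (Suc m))"
  proof (rule levels_below_take)
    fix n assume "n < Suc m"
    then have "b ^ n \<le> b ^ m" "b ^ n \<le> b ^ Suc m" using assms by (auto intro!: power_increasing simp del: power_Suc)
    then show "take (b ^ n) (map y [0..<b ^ Suc m]) = take (b ^ n) (map y [0..<b ^ m])"
      by (simp add: take_map take_upt del: power_Suc)
  qed
  then show "entering b r sel y (Suc m) = fst (fst (level_result b r sel y m))"
    unfolding * entering_def .
qed

lemma pointer_level_result:
  "1 < b \<Longrightarrow> pointer b r sel y m \<kappa> = fst (fst (level_result b r sel y m)) ! \<kappa>"
  by (simp add: pointer_def level_result_Suc)

lemma level_sum_pointer:
  assumes "1 < b" "r \<le> m"
  shows "level_sum b r sel y m = (\<Sum>\<kappa>\<in>block b (m - r).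
    cmod (fst (fast_transform b m (map y [0..<b ^ m])) ! pointer b r sel y m \<kappa>))"
  unfolding level_sum_def pointer_level_result[OF assms(1)]
  by (simp add: level_result_def level_step_sum[OF assms(2)])


section \<open>The adaptive loop\<close>

lemma mean_costed_map: "mean_costed (map y [0..<b ^ m]) = (sample_mean b y m, b ^ m + 1)"
  unfolding mean_costed_def and_then_def for_each_accumulate
  by (simp add: sample_mean_def interv_sum_list_conv_sum_set_nat lessThan_atLeast0)

text \<open>The stored values always form an initial segment of \<open>y\<close>, so their number
  \<open>N\<close> describes them: \<open>b ^ m\<close> on the first pass, a lower power of
  \<open>b\<close> afterwards.\<close>

lemma adaptive_loop_unfold:
  assumes "1 < b" "N \<le> b ^ m"
  shows "adaptive_loop b r sel y C \<epsilon> m (entering b r sel y m) (map y [0..<N]) c =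
    (let c' = c + snd (level_result b r sel y m) + 2 in
     if C m * level_sum b r sel y m \<le> \<epsilon> then Some (sample_mean b y m, m, b ^ m, c' + b ^ m + 1)
     else adaptive_loop b r sel y C \<epsilon> (Suc m) (entering b r sel y (Suc m)) (map y [0..<b ^ m]) c')"
proof -
  have "[0..<b ^ m] = [0..<N] @ [N..<b ^ m]"
    using assms(2) upt_add_eq_append[of 0 N "b ^ m - N"] by simp
  then have "map y [0..<N] @ map y [N..<b ^ m] = map y [0..<b ^ m]" by simp
  then show ?thesis
    by (subst adaptive_loop.simps)
      (simp add: Let_def mean_costed_map level_sum_def level_result_Suc(2)[OF assms(1)]
        flip: level_result_def)
qed

text \<open>Induction downwards from \<open>M\<close>: there the test succeeds, and a failed test at
  \<open>m < M\<close> hands over to level \<open>Suc m\<close>.\<close>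

lemma adaptive_loop_terminates:
  assumes "1 < b" "m \<le> M" "C M * level_sum b r sel y M \<le> \<epsilon>" "N \<le> b ^ m"
  shows "adaptive_loop b r sel y C \<epsilon> m (entering b r sel y m) (map y [0..<N]) c \<noteq> None"
  using assms(2,4)
proof (induction arbitrary: N c rule: inc_induct)
  case base
  then show ?case using assms(3) by (simp add: adaptive_loop_unfold[OF assms(1)] Let_def)
next
  case (step m)
  have "b ^ m \<le> b ^ Suc m" using assms(1) by (intro power_increasing) auto
  from step.IH[OF this] show ?case
    using step.prems by (simp add: adaptive_loop_unfold[OF assms(1), of _ m] Let_def)
qed

text \<open>The cost bound is the one that \<open>level_cost_step\<close> gives after level
  \<open>M\<close>, plus \<open>b ^ M + 1\<close> for the sample mean.\<close>

definition run_result ::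
  "nat \<Rightarrow> nat \<Rightarrow> selection_rule \<Rightarrow> (nat \<Rightarrow> complex) \<Rightarrow> (nat \<Rightarrow> real) \<Rightarrow> real \<Rightarrow>
   nat \<Rightarrow> complex \<times> nat \<times> nat \<times> nat \<Rightarrow> bool" where
  "run_result b r sel y C \<epsilon> m out \<longleftrightarrow> (\<exists>M c. out = (sample_mean b y M, M, b ^ M, c) \<and> m \<le> M
    \<and> C M * level_sum b r sel y M \<le> \<epsilon>
    \<and> (\<forall>n. m \<le> n \<and> n < M \<longrightarrow> \<not> C n * level_sum b r sel y n \<le> \<epsilon>)
    \<and> c \<le> (2 * b + 6) * Suc M * b ^ Suc M + b ^ M + 1)"

text \<open>The bound reproduces itself: the old total and the new level each cost at most
  \<open>(2 * b + 6) * (Suc m * b ^ m)\<close>, and \<open>2 \<le> b\<close> absorbs the doubling.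
  Having 6 instead of 4 pays for the stopping test.\<close>

lemma level_cost_step:
  assumes b: "1 < b" and c: "c \<le> (2 * b + 6) * m * b ^ m"
  shows "c + snd (level_result b r sel y m) + 2 \<le> (2 * b + 6) * Suc m * b ^ Suc m"
proof -
  have "snd (level_result b r sel y m) \<le> (2 * b + 4) * Suc m * b ^ m"
    unfolding level_result_def by (rule level_step_cost[OF b])
  moreover have "(2 * b + 6) * (Suc m * b ^ m) = (2 * b + 4) * Suc m * b ^ m + 2 * (Suc m * b ^ m)"
    by (simp only: mult.assoc flip: distrib_right) simp
  moreover have "0 < Suc m * b ^ m" using b by simp
  ultimately have "snd (level_result b r sel y m) + 2 \<le> (2 * b + 6) * (Suc m * b ^ m)"
    by linarith
  moreover have "c \<le> (2 * b + 6) * (Suc m * b ^ m)"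
    using c by (simp add: algebra_simps)
  ultimately have "c + snd (level_result b r sel y m) + 2 \<le> (2 * b + 6) * (Suc m * b ^ m) * 2"
    by linarith
  also have "\<dots> \<le> (2 * b + 6) * (Suc m * b ^ m) * b"
    using b by (intro mult_le_mono2) simp
  finally show ?thesis by (simp only: power_Suc ac_simps)
qed

lemma adaptive_loop_result:
  assumes "adaptive_loop b r sel y C \<epsilon> m (entering b r sel y m) (map y [0..<N]) c = Some out"
    "1 < b" "N \<le> b ^ m" "c \<le> (2 * b + 6) * m * b ^ m"
  shows "run_result b r sel y C \<epsilon> m out"
proof -
  \<comment> \<open>Fixpoint induction for terminating runs generalizes over all arguments of the
    loop, so the invariants on \<nu>, \<open>ys\<close> and \<open>c\<close> are premises inside the
    predicate.\<close>
  let ?P = "\<lambda>b r sel y C \<epsilon> m \<nu> ys c out. 1 < b \<longrightarrow> \<nu> = entering b r sel y m \<longrightarrow>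
    (\<forall>N. ys = map y [0..<N] \<longrightarrow> N \<le> b ^ m \<longrightarrow> c \<le> (2 * b + 6) * m * b ^ m \<longrightarrow>
      run_result b r sel y C \<epsilon> m out)"
  have "?P b r sel y C \<epsilon> m (entering b r sel y m) (map y [0..<N]) c out"
  proof (rule adaptive_loop.raw_induct[where P = ?P, OF _ assms(1)], intro impI allI)
    fix loop b r sel y C \<epsilon> m \<nu> ys c out N
    assume IH: "\<And>b r sel y C \<epsilon> m \<nu> ys c out. loop b r sel y C \<epsilon> m \<nu> ys c = Some out \<Longrightarrow>
        ?P b r sel y C \<epsilon> m \<nu> ys c out"
      and body: "(let ys' = ys @ map y [length ys..<b ^ m];
            step = level_step b r sel ys' m \<nu>; \<nu>' = fst (fst step);
            S = the (snd (fst step)); c' = c + snd step + 2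
        in if C m * S \<le> \<epsilon>
           then Some (fst (mean_costed ys'), m, length ys', c' + snd (mean_costed ys'))
           else loop b r sel y C \<epsilon> (Suc m) \<nu>' ys' c') = Some out"
      and b: "1 < b" and \<nu>: "\<nu> = entering b r sel y m" and ys: "ys = map y [0..<N]"
      and N: "N \<le> b ^ m" and c: "c \<le> (2 * b + 6) * m * b ^ m"
    let ?c = "c + snd (level_result b r sel y m) + 2"
    have c': "?c \<le> (2 * b + 6) * Suc m * b ^ Suc m" using level_cost_step[OF b c] .
    have ys': "ys @ map y [length ys..<b ^ m] = map y [0..<b ^ m]"
      using N upt_add_eq_append[of 0 N "b ^ m - N"] by (simp add: ys flip: map_append)
    have body': "(if C m * level_sum b r sel y m \<le> \<epsilon>
        then Some (sample_mean b y m, m, b ^ m, ?c + (b ^ m + 1))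
        else loop b r sel y C \<epsilon> (Suc m) (entering b r sel y (Suc m)) (map y [0..<b ^ m]) ?c) = Some out"
      using body unfolding Let_def ys' \<nu> level_result_def[symmetric] level_sum_def[symmetric]
        level_result_Suc(2)[OF b, symmetric] mean_costed_map fst_conv snd_conv
      by (simp only: length_map length_upt diff_zero)
    show "run_result b r sel y C \<epsilon> m out"
    proof (cases "C m * level_sum b r sel y m \<le> \<epsilon>")
      case True
      then show ?thesis using body' c' by (auto simp: run_result_def)
    next
      case False
      have "b ^ m \<le> b ^ Suc m" using b by (intro power_increasing) auto
      then have "run_result b r sel y C \<epsilon> (Suc m) out"
        using IH body' False b c' by presburger
      then obtain M c1 where "out = (sample_mean b y M, M, b ^ M, c1)" "Suc m \<le> M"
        "C M * level_sum b r sel y M \<le> \<epsilon>"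
        "\<And>n. Suc m \<le> n \<Longrightarrow> n < M \<Longrightarrow> \<not> C n * level_sum b r sel y n \<le> \<epsilon>"
        "c1 \<le> (2 * b + 6) * Suc M * b ^ Suc M + b ^ M + 1"
        unfolding run_result_def by blast
      then show ?thesis
        unfolding run_result_def using False by (metis Suc_leD Suc_leI le_neq_implies_less)
    qed
  qed
  then show ?thesis using assms by blast
qed

lemma adaptive_cubature_result:
  assumes "adaptive_cubature b lstar \<omega>hat \<omega>ring r sel \<epsilon> y = Some out" "1 < b"
  shows "run_result b r sel y (err_factor \<omega>hat \<omega>ring r) \<epsilon> (lstar + r) out"
proof (rule adaptive_loop_result)
  show "adaptive_loop b r sel y (err_factor \<omega>hat \<omega>ring r) \<epsilon> (lstar + r)
      (entering b r sel y (lstar + r)) (map y [0..<b ^ (lstar + r)])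
      (snd (levels_below b r sel (map y [0..<b ^ (lstar + r)]) (lstar + r))) = Some out"
    using assms(1) by (simp add: adaptive_cubature_def Let_def entering_def)
  have "snd (levels_below b r sel (map y [0..<b ^ (lstar + r)]) (lstar + r))
      \<le> (2 * b + 4) * (lstar + r) * b ^ (lstar + r)"
    by (rule levels_below_cost[OF assms(2)])
  also have "\<dots> \<le> (2 * b + 6) * (lstar + r) * b ^ (lstar + r)"
    by (intro mult_le_mono1) simp
  finally show "snd (levels_below b r sel (map y [0..<b ^ (lstar + r)]) (lstar + r))
      \<le> (2 * b + 6) * (lstar + r) * b ^ (lstar + r)" .
qed (use assms in auto)

lemma adaptive_cubature_terminates:
  assumes "1 < b" "lstar + r \<le> M" "err_factor \<omega>hat \<omega>ring r M * level_sum b r sel y M \<le> \<epsilon>"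
  shows "adaptive_cubature b lstar \<omega>hat \<omega>ring r sel \<epsilon> y \<noteq> None"
  using adaptive_loop_terminates[where C = "err_factor \<omega>hat \<omega>ring r", OF assms order_refl]
  by (simp add: adaptive_cubature_def Let_def entering_def)


section \<open>Bounds on the cone\<close>

text \<open>The discrete Walsh coefficient without the unimodular phase of the shift; the computed
  sums contain only its modulus.\<close>

definition dwt :: "nat \<Rightarrow> (nat \<Rightarrow> real ^ 'd) \<Rightarrow> (nat \<Rightarrow> complex) \<Rightarrow> nat \<Rightarrow> nat ^ 'd \<Rightarrow> complex" where
  "dwt b z y m k = fst (fast_transform b m (map y [0..<b ^ m])) ! nu_tilde b z m k"

text \<open>A divergent right-hand side is \<infinity>; otherwise the series converges absolutely
  and the triangle inequality applies.\<close>

lemma ennreal_norm_sums_le: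
  fixes g :: "nat \<Rightarrow> 'a :: banach"
  assumes "g sums s"
  shows "ennreal (norm s) \<le> (\<Sum>n. ennreal (norm (g n)))"
proof (cases "(\<Sum>n. ennreal (norm (g n))) = top")
  case False
  then have "summable (\<lambda>n. norm (g n))" by (intro summable_suminf_not_top) auto
  then show ?thesis
    using summable_norm[of g] sums_unique[OF assms] by (simp add: suminf_ennreal2 ennreal_leI)
qed simp

section \<open>Discrete against exact Walsh coefficients\<close>

context
  fixes b :: nat and z :: "nat \<Rightarrow> real ^ 'd" and \<Delta> kt f
  assumes b: "1 < b" and z: "digital_sequence b z" and ok: "\<And>i. ok b (z i) \<Delta>"
    and kt: "wavenumber_map b z kt"
    and ser: "\<And>i. equals_walsh_series_at b f (dplus b (z i) \<Delta>)"
begin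

text \<open>Since \<open>kt\<close> is bijective, \<open>wavenumber_map_agree_iff\<close> identifies
  the wavenumbers that survive in \<open>aliasing\<close> with the values of \<open>kt\<close> on
  one residue class modulo \<open>b ^ m\<close>, and the sum is reindexed over it.\<close>

lemma dwt_sums:
  assumes \<kappa>: "\<kappa> < b ^ m"
  shows "(\<lambda>j. walsh_coeff b f (kt (\<kappa> + j * b ^ m)) * walsh b (kt (\<kappa> + j * b ^ m)) \<Delta>) sums
    dwt b z (\<lambda>i. f (dplus b (z i) \<Delta>)) m (kt \<kappa>)"
proof -
  define h where "h j = kt (\<kappa> + j * b ^ m)" for j
  let ?g = "\<lambda>k. walsh_coeff b f k * walsh b k \<Delta>"
  let ?D = "dwt b z (\<lambda>i. f (dplus b (z i) \<Delta>)) m (kt \<kappa>)"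
  have inj: "inj h"
  proof (rule injI)
    fix i j assume "h i = h j"
    then have "\<kappa> + i * b ^ m = \<kappa> + j * b ^ m"
      unfolding h_def by (rule injD[OF wavenumber_map_inj[OF b kt]])
    then show "i = j" using b by simp
  qed
  have agree: "k \<in> range h \<longleftrightarrow> agree b z m k (kt \<kappa>)" for k
  proof -
    have "surj kt" using kt by (simp add: wavenumber_map_def)
    then obtain \<kappa>' where k: "k = kt \<kappa>'" by (rule surjE)
    have "k \<in> range h \<longleftrightarrow> (\<exists>j. \<kappa>' = \<kappa> + j * b ^ m)"
      by (simp add: k h_def image_iff inj_eq[OF wavenumber_map_inj[OF b kt]])
    also have "\<dots> \<longleftrightarrow> \<kappa>' mod b ^ m = \<kappa>"
      using \<kappa> by (metis mod_div_mult_eq mod_less mod_mult_self1)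
    finally show ?thesis
      using \<kappa> by (simp add: k wavenumber_map_agree_iff[OF b kt])
  qed
  have "((\<lambda>k. if agree b z m k (kt \<kappa>) then ?g k else 0) has_sum ?D) UNIV"
    using aliasing[OF b z ok ser, of m "kt \<kappa>"]
    by (simp add: dwt_def fast_transform_nu_tilde[OF b z] agree_def)
  also have "?this \<longleftrightarrow> (?g has_sum ?D) (range h)"
    by (rule has_sum_cong_neutral) (use agree in auto)
  finally have "((?g \<circ> h) has_sum ?D) UNIV" by (simp add: has_sum_reindex[OF inj])
  from has_sum_imp_sums[OF this] show ?thesis by (simp add: h_def o_def)
qed

text \<open>The term \<open>j = 0\<close> of \<open>dwt_sums\<close> is moved to the left; Walsh
  functions have modulus 1.\<close>

lemma dwt_error:
  assumes \<kappa>: "\<kappa> < b ^ m"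
  shows "ennreal (cmod (dwt b z (\<lambda>i. f (dplus b (z i) \<Delta>)) m (kt \<kappa>)
      - walsh_coeff b f (kt \<kappa>) * walsh b (kt \<kappa>) \<Delta>))
    \<le> (\<Sum>j. ennreal (cmod (walsh_coeff b f (kt (\<kappa> + Suc j * b ^ m)))))"
proof -
  have "(\<lambda>j. walsh_coeff b f (kt (\<kappa> + Suc j * b ^ m)) * walsh b (kt (\<kappa> + Suc j * b ^ m)) \<Delta>) sums
    (dwt b z (\<lambda>i. f (dplus b (z i) \<Delta>)) m (kt \<kappa>) - walsh_coeff b f (kt \<kappa>) * walsh b (kt \<kappa>) \<Delta>)"
    using sums_Suc_iff dwt_sums[OF \<kappa>] by fastforce
  from ennreal_norm_sums_le[OF this] show ?thesis
    by (simp add: norm_mult walsh_additive_char)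
qed

text \<open>The reverse triangle inequality, applied to each \<kappa> in the block.\<close>

lemma dwt_block_sum:
  assumes "l \<le> m"
  shows "ennreal \<bar>(\<Sum>\<kappa>\<in>block b l. cmod (dwt b z (\<lambda>i. f (dplus b (z i) \<Delta>)) m (kt \<kappa>))) - S_fin b kt f l\<bar>
    \<le> S_hat b kt f l m"
proof -
  let ?D = "\<lambda>\<kappa>. dwt b z (\<lambda>i. f (dplus b (z i) \<Delta>)) m (kt \<kappa>)"
  let ?c = "\<lambda>\<kappa>. walsh_coeff b f (kt \<kappa>) * walsh b (kt \<kappa>) \<Delta>"
  have S: "S_fin b kt f l = (\<Sum>\<kappa>\<in>block b l. cmod (?c \<kappa>))"
    by (simp add: S_fin_def norm_mult walsh_additive_char)
  have "\<bar>(\<Sum>\<kappa>\<in>block b l. cmod (?D \<kappa>)) - S_fin b kt f l\<bar>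
      = \<bar>\<Sum>\<kappa>\<in>block b l. cmod (?D \<kappa>) - cmod (?c \<kappa>)\<bar>"
    by (simp only: S sum_subtractf)
  also have "\<dots> \<le> (\<Sum>\<kappa>\<in>block b l. \<bar>cmod (?D \<kappa>) - cmod (?c \<kappa>)\<bar>)" by (rule sum_abs)
  also have "\<dots> \<le> (\<Sum>\<kappa>\<in>block b l. cmod (?D \<kappa> - ?c \<kappa>))"
    by (intro sum_mono norm_triangle_ineq3)
  finally have "ennreal \<bar>(\<Sum>\<kappa>\<in>block b l. cmod (?D \<kappa>)) - S_fin b kt f l\<bar>
      \<le> ennreal (\<Sum>\<kappa>\<in>block b l. cmod (?D \<kappa> - ?c \<kappa>))"
    by (rule ennreal_leI)
  also have "\<dots> = (\<Sum>\<kappa>\<in>block b l. ennreal (cmod (?D \<kappa> - ?c \<kappa>)))" by simp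
  also have "\<dots> \<le> S_hat b kt f l m"
    unfolding S_hat_def
  proof (intro sum_mono dwt_error)
    fix \<kappa> assume "\<kappa> \<in> block b l"
    then have "\<kappa> < b ^ l" by (simp add: block_def)
    also have "b ^ l \<le> b ^ m" using b assms by (intro power_increasing) auto
    finally show "\<kappa> < b ^ m" .
  qed
  finally show ?thesis .
qed

text \<open>The case \<kappa> = 0 of \<open>dwt_error\<close>: at wavenumber 0 the discrete
  coefficient is the sample mean and the exact one the integral.\<close>

lemma cubature_error:
  "ennreal (cmod (cube_integral f - sample_mean b (\<lambda>i. f (dplus b (z i) \<Delta>)) m)) \<le> S_hat b kt f 0 m"
proof -
  have kt0: "kt 0 = 0" using kt by (simp add: wavenumber_map_def)
  have mean: "dwt b z (\<lambda>i. f (dplus b (z i) \<Delta>)) m 0 = sample_mean b (\<lambda>i. f (dplus b (z i) \<Delta>)) m"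
    by (simp add: dwt_def fast_transform_nu_tilde[OF b z] pairing_zero_left sample_mean_def)
  have int: "walsh_coeff b f 0 * walsh b 0 \<Delta> = cube_integral f"
    by (simp add: walsh_coeff_def walsh_def pairing_zero_left)
  \<comment> \<open>The lower end is \<open>b ^ 0 div b = 0\<close>.\<close>
  have "block b 0 = {0}" using b by (auto simp: block_def)
  then have "S_hat b kt f 0 m = (\<Sum>j. ennreal (cmod (walsh_coeff b f (kt (0 + Suc j * b ^ m)))))"
    by (simp only: S_hat_def) simp
  moreover have "0 < b ^ m" using b by simp
  ultimately show ?thesis
    using dwt_error[of 0 m] unfolding kt0 mean int by (simp only: norm_minus_commute)
qed

end

section \<open>Consequences of the cone conditions\<close>

lemma S_fin_nonneg: "0 \<le> S_fin b kt f l"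
  by (simp add: S_fin_def sum_nonneg)

lemma integrand_coneD:
  assumes "f \<in> integrand_cone b kt lstar \<omega>hat \<omega>ring" "l \<le> m"
  shows "S_hat b kt f l m \<le> ennreal (\<omega>hat (m - l)) * S_check b kt f m"
    and "lstar \<le> l \<Longrightarrow> S_check b kt f m \<le> ennreal (\<omega>ring (m - l)) * ennreal (S_fin b kt f l)"
  using assms by (simp_all add: integrand_cone_def)

text \<open>Both cone conditions are chained, the second one always from level
  \<open>m - r \<ge> lstar\<close>. The resulting bound is finite, so the inequality returns from
  \<open>ennreal\<close> to the reals.\<close>

lemma cone_S_hat:
  assumes f: "f \<in> integrand_cone b kt lstar \<omega>hat \<omega>ring"
    and nonneg: "\<And>n. 0 \<le> \<omega>hat n" "\<And>n. 0 \<le> \<omega>ring n"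
    and m: "lstar + r \<le> m" "l \<le> m" and x: "ennreal x \<le> S_hat b kt f l m"
  shows "x \<le> \<omega>hat (m - l) * (\<omega>ring r * S_fin b kt f (m - r))"
proof -
  have "S_check b kt f m \<le> ennreal (\<omega>ring (m - (m - r))) * ennreal (S_fin b kt f (m - r))"
    using m(1) by (intro integrand_coneD(2)[OF f]) auto
  also have "m - (m - r) = r" using m by simp
  finally have "ennreal (\<omega>hat (m - l)) * S_check b kt f m
      \<le> ennreal (\<omega>hat (m - l)) * (ennreal (\<omega>ring r) * ennreal (S_fin b kt f (m - r)))"
    by (rule mult_left_mono) simp
  moreover have "S_hat b kt f l m \<le> ennreal (\<omega>hat (m - l)) * S_check b kt f m"
    by (rule integrand_coneD(1)[OF f m(2)])
  ultimately have "ennreal x \<le> ennreal (\<omega>hat (m - l)) * (ennreal (\<omega>ring r) * ennreal (S_fin b kt f (m - r)))"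
    using x by order
  also have "\<dots> = ennreal (\<omega>hat (m - l) * (\<omega>ring r * S_fin b kt f (m - r)))"
    by (simp add: ennreal_mult nonneg S_fin_nonneg)
  finally show ?thesis
    using nonneg S_fin_nonneg[of b kt f "m - r"] by (subst (asm) ennreal_le_iff) simp_all
qed

text \<open>The block of level \<open>Suc m\<close> is an initial piece of the tail summed by
  \<open>S_check\<close> at level \<open>m\<close>.\<close>

lemma S_fin_Suc_le:
  assumes b: "1 < b"
  shows "ennreal (S_fin b kt f (Suc m)) \<le> S_check b kt f m"
proof -
  let ?g = "\<lambda>\<kappa>. cmod (walsh_coeff b f (kt \<kappa>))"
  have "b ^ m \<le> b ^ Suc m" using b by (intro power_increasing) auto
  then have "block b (Suc m) = {0 + b ^ m..<b ^ Suc m - b ^ m + b ^ m}"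
    using b by (simp add: block_def)
  then have "S_fin b kt f (Suc m) = (\<Sum>\<kappa>\<in>{0 + b ^ m..<b ^ Suc m - b ^ m + b ^ m}. ?g \<kappa>)"
    unfolding S_fin_def by (simp only:)
  also have "\<dots> = (\<Sum>\<kappa><b ^ Suc m - b ^ m. ?g (b ^ m + \<kappa>))"
    unfolding sum.shift_bounds_nat_ivl by (simp add: add.commute lessThan_atLeast0)
  finally have "ennreal (S_fin b kt f (Suc m)) = (\<Sum>\<kappa><b ^ Suc m - b ^ m. ennreal (?g (b ^ m + \<kappa>)))"
    by simp
  also have "\<dots> \<le> S_check b kt f m"
    unfolding S_check_def by (rule sum_le_suminf) auto
  finally show ?thesis .
qed

lemma cone_S_fin_decay:
  assumes b: "1 < b" and f: "f \<in> integrand_cone b kt lstar \<omega>hat \<omega>ring"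
    and nonneg: "\<And>n. 0 \<le> \<omega>ring n"
  shows "S_fin b kt f (Suc (lstar + n)) \<le> \<omega>ring n * S_fin b kt f lstar"
proof -
  have "ennreal (S_fin b kt f (Suc (lstar + n))) \<le> S_check b kt f (lstar + n)"
    by (rule S_fin_Suc_le[OF b])
  also have "\<dots> \<le> ennreal (\<omega>ring (lstar + n - lstar)) * ennreal (S_fin b kt f lstar)"
    by (intro integrand_coneD(2)[OF f]) auto
  also have "\<dots> = ennreal (\<omega>ring n * S_fin b kt f lstar)"
    by (simp add: ennreal_mult nonneg S_fin_nonneg)
  finally show ?thesis
    using nonneg S_fin_nonneg[of b kt f lstar] by (subst (asm) ennreal_le_iff) simp_all
qed

lemma err_factor_nonneg:
  "(\<And>n. 0 \<le> \<omega>hat n) \<Longrightarrow> (\<And>n. 0 \<le> \<omega>ring n) \<Longrightarrow> \<omega>hat r * \<omega>ring r < 1 \<Longrightarrow>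
    0 \<le> err_factor \<omega>hat \<omega>ring r m"
  by (simp add: err_factor_def)

text \<open>A bound on \<open>\<omega>hat\<close> bounds the error factor uniformly in
  \<open>m\<close>, so the decay from \<open>cone_S_fin_decay\<close> pushes the product below
  \<epsilon>.\<close>

lemma sufficient_levels_nonempty:
  assumes b: "1 < b" and f: "f \<in> integrand_cone b kt lstar \<omega>hat \<omega>ring"
    and nonneg: "\<And>n. 0 \<le> \<omega>hat n" "\<And>n. 0 \<le> \<omega>ring n" and lim: "\<omega>ring \<longlonglongrightarrow> 0"
    and r: "\<omega>hat r * \<omega>ring r < 1" and \<epsilon>: "0 < \<epsilon>" and bdd: "bdd_above (range \<omega>hat)"
  shows "sufficient_levels b kt lstar \<omega>hat \<omega>ring r \<epsilon> f \<noteq> {}"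
proof -
  obtain B where B: "\<And>n. \<omega>hat n \<le> B" using bdd by (auto simp: bdd_above_def)
  define A where "A = B * \<omega>ring r / (1 - \<omega>hat r * \<omega>ring r) * (1 + \<omega>hat r * \<omega>ring r)"
  have "(\<lambda>n. A * (\<omega>ring n * S_fin b kt f lstar)) \<longlonglongrightarrow> A * (0 * S_fin b kt f lstar)"
    by (intro tendsto_intros lim)
  then have "\<forall>\<^sub>F n in sequentially. A * (\<omega>ring n * S_fin b kt f lstar) < \<epsilon>"
    using \<epsilon> by (intro order_tendstoD(2)) auto
  then obtain n where n: "A * (\<omega>ring n * S_fin b kt f lstar) < \<epsilon>"
    by (auto simp: eventually_sequentially)
  \<comment> \<open>Chosen so that \<open>m - r\<close> is the index in
    \<open>cone_S_fin_decay\<close>.\<close>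
  define m where "m = Suc (lstar + n) + r"
  have "err_factor \<omega>hat \<omega>ring r m * (1 + \<omega>hat r * \<omega>ring r) \<le> A"
    unfolding err_factor_def A_def using nonneg r B
    by (intro mult_right_mono divide_right_mono) auto
  moreover have "S_fin b kt f (m - r) \<le> \<omega>ring n * S_fin b kt f lstar"
    using cone_S_fin_decay[OF b f nonneg(2)] by (simp add: m_def)
  moreover have "0 \<le> err_factor \<omega>hat \<omega>ring r m * (1 + \<omega>hat r * \<omega>ring r)"
    using nonneg r by (simp add: err_factor_nonneg)
  ultimately have "err_factor \<omega>hat \<omega>ring r m * (1 + \<omega>hat r * \<omega>ring r) * S_fin b kt f (m - r)
      \<le> A * (\<omega>ring n * S_fin b kt f lstar)"
    using S_fin_nonneg by (intro mult_mono) (auto intro: order_trans)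
  then have "m \<in> sufficient_levels b kt lstar \<omega>hat \<omega>ring r \<epsilon> f"
    using n by (simp add: sufficient_levels_def m_def)
  then show ?thesis by blast
qed

section \<open>Error, final level and cost of a run\<close>

theorem theorem1:
  fixes b :: nat
  assumes "prime b"
  shows "\<exists>K::real. \<forall>(z :: nat \<Rightarrow> real ^ 'd) \<Delta> kt lstar \<omega>hat \<omega>ring r \<epsilon> f sel y out.
    digital_sequence b z \<longrightarrow>
    \<Delta> \<in> unit_cube \<longrightarrow> (\<forall>i. ok b (z i) \<Delta>) \<longrightarrow>
    wavenumber_map b z kt \<longrightarrow>
    1 \<le> lstar \<longrightarrow>
    (\<forall>m. 0 \<le> \<omega>hat m) \<longrightarrow> (\<forall>m. 0 \<le> \<omega>ring m) \<longrightarrow> \<omega>ring \<longlonglongrightarrow> 0 \<longrightarrow>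
    1 \<le> r \<longrightarrow> \<omega>hat r * \<omega>ring r < 1 \<longrightarrow>
    0 < \<epsilon> \<longrightarrow>
    f \<in> integrand_cone b kt lstar \<omega>hat \<omega>ring \<longrightarrow>
    (\<forall>i. equals_walsh_series_at b f (dplus b (z i) \<Delta>)) \<longrightarrow>
    selects_max b sel \<longrightarrow>
    y = (\<lambda>i. f (dplus b (z i) \<Delta>)) \<longrightarrow>
    out = adaptive_cubature b lstar \<omega>hat \<omega>ring r sel \<epsilon> y \<longrightarrow>
    constructed_by_pointers b z lstar r sel y out kt \<longrightarrow>
      (\<forall>Q m n c. out = Some (Q, m, n, c) \<longrightarrow>
         Q = sample_mean b y m \<and>
         cmod (cube_integral f - sample_mean b y m) \<le> \<epsilon> \<and>
         n = b ^ m \<and>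
         (sufficient_levels b kt lstar \<omega>hat \<omega>ring r \<epsilon> f \<noteq> {} \<longrightarrow>
            m \<le> Inf (sufficient_levels b kt lstar \<omega>hat \<omega>ring r \<epsilon> f)) \<and>
         real c \<le> K * real (m * b ^ m)) \<and>
      (sufficient_levels b kt lstar \<omega>hat \<omega>ring r \<epsilon> f \<noteq> {} \<longrightarrow> out \<noteq> None) \<and>
      (bdd_above (range \<omega>hat) \<longrightarrow> sufficient_levels b kt lstar \<omega>hat \<omega>ring r \<epsilon> f \<noteq> {})"
\<comment> \<open>The cost bound of \<open>run_result\<close> gives this constant:
  \<open>Suc m \<le> m + m\<close> and \<open>b ^ Suc m = b * b ^ m\<close> yield the first summand,
  \<open>b ^ m + 1 \<le> 2 * (m * b ^ m)\<close> the 2. Here \<open>m \<ge> 1\<close> because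
  \<open>lstar \<ge> 1\<close>.\<close>
proof (intro exI[of _ "real ((2 * b + 6) * 2 * b + 2)"] allI impI)
  fix z :: "nat \<Rightarrow> real ^ 'd" and \<Delta> kt lstar \<omega>hat \<omega>ring r \<epsilon> f sel y out
  assume z: "digital_sequence b z" and "\<forall>i. ok b (z i) \<Delta>" and kt: "wavenumber_map b z kt"
    and lstar: "1 \<le> lstar" and "\<forall>m. 0 \<le> \<omega>hat m" "\<forall>m. 0 \<le> \<omega>ring m"
    and lim: "\<omega>ring \<longlonglongrightarrow> 0" and p: "\<omega>hat r * \<omega>ring r < 1" and \<epsilon>: "0 < \<epsilon>"
    and f: "f \<in> integrand_cone b kt lstar \<omega>hat \<omega>ring"
    and "\<forall>i. equals_walsh_series_at b f (dplus b (z i) \<Delta>)"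
    and y: "y = (\<lambda>i. f (dplus b (z i) \<Delta>))"
    and out: "out = adaptive_cubature b lstar \<omega>hat \<omega>ring r sel \<epsilon> y"
    and cons: "constructed_by_pointers b z lstar r sel y out kt"
  then have ok: "ok b (z i) \<Delta>" and ser: "equals_walsh_series_at b f (dplus b (z i) \<Delta>)"
    and nonneg: "0 \<le> \<omega>hat i" "0 \<le> \<omega>ring i" for i by auto
  have b: "1 < b" using assms by (rule prime_gt_1_nat)
  let ?C = "err_factor \<omega>hat \<omega>ring r" and ?L = "sufficient_levels b kt lstar \<omega>hat \<omega>ring r \<epsilon> f"
  let ?S = "\<lambda>m. S_fin b kt f (m - r)" and ?T = "level_sum b r sel y"
  define p where "p = \<omega>hat r * \<omega>ring r"
  note p = p[folded p_def]
  \<comment> \<open>The pointers are tied to \<open>kt\<close> only at levels that the run reaches,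
    which is what \<open>before\<close> expresses.\<close>
  have T: "\<bar>?T m - ?S m\<bar> \<le> p * ?S m"
    if m: "lstar + r \<le> m" and before: "\<And>Q m' n c. out = Some (Q, m', n, c) \<Longrightarrow> m \<le> m'" for m
  proof -
    have "pointer b r sel y m \<kappa> = nu_tilde b z m (kt \<kappa>)" if "\<kappa> \<in> block b (m - r)" for \<kappa>
      using cons m before that unfolding constructed_by_pointers_def by blast
    then have "?T m = (\<Sum>\<kappa>\<in>block b (m - r). cmod (dwt b z y m (kt \<kappa>)))"
      using m by (simp add: level_sum_pointer[OF b] dwt_def)
    then have "ennreal \<bar>?T m - ?S m\<bar> \<le> S_hat b kt f (m - r) m"
      using dwt_block_sum[OF b z ok kt ser, of "m - r" m] by (simp add: y)
    from cone_S_hat[OF f nonneg m _ this] show ?thesis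
      using m by (simp add: p_def mult.assoc)
  qed
  have test: "?C m * ?T m \<le> \<epsilon>"
    if m: "m \<in> ?L" and before: "\<And>Q m' n c. out = Some (Q, m', n, c) \<Longrightarrow> m \<le> m'" for m
  proof -
    have "?T m \<le> (1 + p) * ?S m"
      using T[OF _ before] m by (simp add: sufficient_levels_def abs_le_iff algebra_simps)
    then have "?C m * ?T m \<le> ?C m * ((1 + p) * ?S m)"
      using nonneg p by (intro mult_left_mono) (simp_all add: err_factor_nonneg p_def)
    also have "\<dots> \<le> \<epsilon>" using m by (simp add: sufficient_levels_def p_def mult.assoc)
    finally show ?thesis .
  qed
  have final: "Q = sample_mean b y m \<and> cmod (cube_integral f - sample_mean b y m) \<le> \<epsilon> \<and>
         n = b ^ m \<and> (?L \<noteq> {} \<longrightarrow> m \<le> Inf ?L) \<and>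
         real c \<le> real ((2 * b + 6) * 2 * b + 2) * real (m * b ^ m)"
    if some: "out = Some (Q, m, n, c)" for Q m n c
  proof -
    have "run_result b r sel y ?C \<epsilon> (lstar + r) (Q, m, n, c)"
      using adaptive_cubature_result[OF _ b] some out by simp
    then have res: "Q = sample_mean b y m" "n = b ^ m" "lstar + r \<le> m" "?C m * ?T m \<le> \<epsilon>"
      and first: "\<And>n. lstar + r \<le> n \<Longrightarrow> n < m \<Longrightarrow> \<not> ?C n * ?T n \<le> \<epsilon>"
      and c: "c \<le> (2 * b + 6) * Suc m * b ^ Suc m + b ^ m + 1"
      by (auto simp: run_result_def)
    have "\<bar>?T m - ?S m\<bar> \<le> p * ?S m" using T[OF res(3)] some by simp
    \<comment> \<open>The lower bound \<open>(1 - p) * ?S m \<le> ?T m\<close> is solved for the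
      unknown sum, using \<open>p < 1\<close>.\<close>
    then have S: "?S m \<le> ?T m / (1 - p)"
      using p by (simp add: pos_le_divide_eq abs_le_iff algebra_simps)
    have "cmod (cube_integral f - sample_mean b y m) \<le> \<omega>hat (m - 0) * (\<omega>ring r * ?S m)"
      using cubature_error[OF b z ok kt ser, of m] unfolding y
      by (rule cone_S_hat[OF f nonneg res(3) le0])
    also have "\<dots> \<le> \<omega>hat m * (\<omega>ring r * (?T m / (1 - p)))"
      unfolding diff_zero by (intro mult_left_mono S nonneg)
    also have "\<dots> = ?C m * ?T m" by (simp add: err_factor_def p_def)
    also have "\<dots> \<le> \<epsilon>" by (rule res(4))
    finally have error: "cmod (cube_integral f - sample_mean b y m) \<le> \<epsilon>" .
    \<comment> \<open>A sufficient level below \<open>m\<close> would have been reached and would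
      have passed the test, but \<open>m\<close> is the first level to pass.\<close>
    have level: "m \<le> Inf ?L" if "?L \<noteq> {}"
    proof (rule cInf_greatest[OF that], rule ccontr)
      fix m' assume m': "m' \<in> ?L" "\<not> m \<le> m'"
      then have "?C m' * ?T m' \<le> \<epsilon>" using some by (intro test) auto
      then show False using first[of m'] m' by (simp add: sufficient_levels_def)
    qed
    have "1 \<le> m" using res(3) lstar by simp
    moreover have "1 \<le> b ^ m" using b by simp
    ultimately have "c \<le> (2 * b + 6) * (m + m) * b ^ Suc m + m * b ^ m + m * b ^ m"
      by (intro order_trans[OF c] add_mono mult_le_mono) (auto simp: Suc_le_eq)
    also have "\<dots> = ((2 * b + 6) * 2 * b + 2) * (m * b ^ m)"
      by (simp add: algebra_simps)
    finally have "real c \<le> real ((2 * b + 6) * 2 * b + 2) * real (m * b ^ m)"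
      unfolding of_nat_mult[symmetric] of_nat_le_iff .
    then show ?thesis using res error level by blast
  qed
  \<comment> \<open>A run without end would reach every level, so \<open>test\<close> would hold at
    a sufficient one, and the run would stop by then.\<close>
  have "out \<noteq> None" if nonempty: "?L \<noteq> {}"
  proof
    assume none: "out = None"
    obtain m where m: "m \<in> ?L" using nonempty by blast
    then have "?C m * ?T m \<le> \<epsilon>" using none by (intro test) auto
    moreover have "lstar + r \<le> m" using m by (simp add: sufficient_levels_def)
    ultimately have "out \<noteq> None" unfolding out by (intro adaptive_cubature_terminates[OF b])
    then show False using none by blast
  qed
  moreover have "?L \<noteq> {}" if "bdd_above (range \<omega>hat)"
    using sufficient_levels_nonempty[OF b f nonneg lim p[unfolded p_def] \<epsilon> that] .
  ultimately show "(\<forall>Q m n c. out = Some (Q, m, n, c) \<longrightarrow>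
         Q = sample_mean b y m \<and>
         cmod (cube_integral f - sample_mean b y m) \<le> \<epsilon> \<and>
         n = b ^ m \<and> (?L \<noteq> {} \<longrightarrow> m \<le> Inf ?L) \<and>
         real c \<le> real ((2 * b + 6) * 2 * b + 2) * real (m * b ^ m)) \<and>
      (?L \<noteq> {} \<longrightarrow> out \<noteq> None) \<and> (bdd_above (range \<omega>hat) \<longrightarrow> ?L \<noteq> {})"
    using final by blast
qed

end
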